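(* Let $\mathcal P\subset\mathbb{R}^n$ be an alcoved polytope. For $w\in S_{n-1}$ let $\mathcal P_{(w)}=\{x\in\mathbb{R}^n: \Delta_{(w)}+x\subseteq\mathcal P\}$. Then each $\mathcal P_{(w)}$ is an alcoved polytope (possibly empty), and the normalized volume of $\mathcal P$ is $$\mathrm{Vol}(\mathcal P)=\sum_{w\in S_{n-1}} I(\mathcal P_{(w)}),$$ where $I(Q)=|Q\cap\mathbb{Z}^n|$ denotes the number of lattice points of $Q$.
   Context: An alcoved polytope in $\mathbb{R}^n$ is a polytope of the form $\{x\in\mathbb{R}^n: x_1+\dots+x_n=l,\ b_{ij}\le x_{i+1}+\dots+x_j\le c_{ij}\ (0\le i<j\le n-1)\}$ with $l,b_{ij},c_{ij}\in\mathbb{Z}$. The normalized volume is the $(n-1)$-dimensional volume in the hyperplane $x_1+\dots+x_n=l$, normalized so that a unimodular simplex (equivalently, after projecting to the first $n-1$ coordinates, a simplex of Euclidean volume $1/(n-1)!$) has volume 1. Stanley's map $\psi:[0,1]^{n-1}\to[0,1]^{n-1}$ is $\psi(x)_i=(x_1+\dots+x_i)-\lfloor x_1+\dots+x_i\rfloor$. For $w\in S_{n-1}$, $\nabla_w=\{y: 0<y_{w(1)}<\dots<y_{w(n-1)}<1\}$, $k_w=\mathrm{des}(w^{-1})+1$ where $\mathrm{des}$ counts indices $i$ with $u(i)>u(i+1)$, and $\Delta_{(w)}=\{x\in\mathbb{R}^n: x_1+\dots+x_n=k_w,\ (x_1,\dots,x_{n-1})\in\overline{\psi^{-1}(\nabla_w)}\}$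 (a unit simplex with 0/1 vertices, contained in the hypersimplex $\{x\in[0,1]^n:\sum x_i=k_w\}$). *)

theory Defs
  imports "HOL-Analysis.Analysis" "HOL-Combinatorics.Permutations"
begin

text \<open>
  Points of \<open>\<real>\<^sup>n\<close> are represented as extensional functions on \<open>{1..n}\<close>, which is the carrier
  both of the product topology and of the product measure over \<open>{1..n}\<close>.
\<close>

abbreviation rpoints :: "nat \<Rightarrow> (nat \<Rightarrow> real) set" where
  "rpoints n \<equiv> {1..n} \<rightarrow>\<^sub>E UNIV"

abbreviation lattice_points :: "nat \<Rightarrow> (nat \<Rightarrow> real) set" where
  "lattice_points n \<equiv> {1..n} \<rightarrow>\<^sub>E \<int>"

text \<open>
  A set of this form is always bounded: the constraints with \<open>j = i + 1\<close> bound the first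
  \<open>n - 1\<close> coordinates, and the last one is determined by them. The form thus already forces a
  (possibly empty) polytope.
\<close>

definition alcoved_polytope :: "nat \<Rightarrow> (nat \<Rightarrow> real) set \<Rightarrow> bool" where
  "alcoved_polytope n P \<longleftrightarrow>
     (\<exists>(l :: int) (b :: nat \<Rightarrow> nat \<Rightarrow> int) (c :: nat \<Rightarrow> nat \<Rightarrow> int).
        P = {x \<in> rpoints n.
               (\<Sum>k = 1..n. x k) = of_int l \<and>
               (\<forall>i j. i < j \<and> j \<le> n - 1 \<longrightarrow>
                  of_int (b i j) \<le> (\<Sum>k = i + 1..j. x k) \<and>
                  (\<Sum>k = i + 1..j. x k) \<le> of_int (c i j))})"

definition normalized_volume :: "nat \<Rightarrow> (nat \<Rightarrow> real) set \<Rightarrow> real" where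
  "normalized_volume n P =
     fact (n - 1) *
     measure (Pi\<^sub>M {1..n - 1} (\<lambda>_. lborel)) ((\<lambda>x. restrict x {1..n - 1}) ` P)"

definition stanley_map :: "nat \<Rightarrow> (nat \<Rightarrow> real) \<Rightarrow> nat \<Rightarrow> real" where
  "stanley_map m x = (\<lambda>i\<in>{1..m}. (\<Sum>k = 1..i. x k) - of_int \<lfloor>\<Sum>k = 1..i. x k\<rfloor>)"

definition nabla :: "nat \<Rightarrow> (nat \<Rightarrow> nat) \<Rightarrow> (nat \<Rightarrow> real) set" where
  "nabla m w =
     {y \<in> rpoints m. sorted_wrt (<) ([0] @ map (\<lambda>i. y (w i)) [1..<m + 1] @ [1])}"

definition des :: "nat \<Rightarrow> (nat \<Rightarrow> nat) \<Rightarrow> nat" where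
  "des m u = card {i. 1 \<le> i \<and> i < m \<and> u i > u (i + 1)}"

definition simplex_level :: "nat \<Rightarrow> (nat \<Rightarrow> nat) \<Rightarrow> nat" where
  "simplex_level m w = des m (inv w) + 1"

definition stanley_simplex :: "nat \<Rightarrow> (nat \<Rightarrow> nat) \<Rightarrow> (nat \<Rightarrow> real) set" where
  "stanley_simplex n w =
     {x \<in> rpoints n.
        (\<Sum>k = 1..n. x k) = of_nat (simplex_level (n - 1) w) \<and>
        restrict x {1..n - 1} \<in>
          product_topology (\<lambda>_. euclideanreal) {1..n - 1} closure_of
            {z \<in> {1..n - 1} \<rightarrow>\<^sub>E {0..1}. stanley_map (n - 1) z \<in> nabla (n - 1) w}}"

definition translate :: "nat \<Rightarrow> (nat \<Rightarrow> real) set \<Rightarrow> (nat \<Rightarrow> real) \<Rightarrow> (nat \<Rightarrow> real) set" where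
  "translate n D x = (\<lambda>d. \<lambda>i\<in>{1..n}. d i + x i) ` D"

definition translation_polytope ::
    "nat \<Rightarrow> (nat \<Rightarrow> real) set \<Rightarrow> (nat \<Rightarrow> nat) \<Rightarrow> (nat \<Rightarrow> real) set" where
  "translation_polytope n P w = {x \<in> rpoints n. translate n (stanley_simplex n w) x \<subseteq> P}"

definition lattice_count :: "nat \<Rightarrow> (nat \<Rightarrow> real) set \<Rightarrow> nat" where
  "lattice_count n Q = card (Q \<inter> lattice_points n)"

end

theory Submission imports Defs begin

text \<open>
  Write \<open>m = n - 1\<close> and pass to the partial sums \<open>y\<^sub>i = x\<^sub>1 + \<dots> + x\<^sub>i\<close>, \<open>y\<^sub>0 = 0\<close>, a volume-preserving
  change of coordinates in which the polytope is cut out by \<open>b\<^sub>i\<^sub>j \<le> y\<^sub>j - y\<^sub>i \<le> c\<^sub>i\<^sub>j\<close>. Up to the null set where some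
  \<open>y\<^sub>j - y\<^sub>i\<close> is an integer, \<open>\<real>\<^sup>m\<close> is the disjoint union of the cells \<open>a + \<nabla>\<^sub>w\<close>, where \<open>a\<close> is a lattice point. On
  such a cell \<open>y\<^sub>j - y\<^sub>i\<close> lies strictly between two consecutive integers, so the cell lies inside the
  polytope or is disjoint from it; all cells have the same volume, which is \<open>1 / m!\<close> because \<open>m!\<close> of them
  fill the unit cube. Finally, on \<open>\<psi>\<^sup>-\<^sup>1(\<nabla>\<^sub>w)\<close> the integer part of \<open>y\<^sub>i\<close> is the number of descents of
  \<open>w\<^sup>-\<^sup>1\<close> before \<open>i\<close>, so in the coordinates \<open>y\<close> this set is itself a cell, and the lattice translates of
  \<open>\<Delta>\<^sub>(\<^sub>w\<^sub>)\<close> inside the polytope are exactly the cells with permutation \<open>w\<close> inside it.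
\<close>

section \<open>Measure-preserving changes of coordinates\<close>

abbreviation lborel_pow :: "nat \<Rightarrow> (nat \<Rightarrow> real) measure" where
  "lborel_pow m \<equiv> Pi\<^sub>M {1..m} (\<lambda>_. lborel)"

text \<open>Supplies the convention y_0 = 0, since points of \<open>rpoints m\<close> carry no
  coordinate 0. Bounds on y_j alone then become bounds on differences.\<close>

definition anchor :: "(nat \<Rightarrow> real) \<Rightarrow> nat \<Rightarrow> real" where
  "anchor y i = (if i = 0 then 0 else y i)"

definition psum :: "nat \<Rightarrow> (nat \<Rightarrow> real) \<Rightarrow> nat \<Rightarrow> real" where
  "psum m x = (\<lambda>i\<in>{1..m}. \<Sum>k = 1..i. x k)"

interpretation lborel_product: product_sigma_finite "\<lambda>_::nat. lborel :: real measure"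
  by standard

lemma space_lborel_pow: "space (lborel_pow m) = rpoints m"
  by (simp add: space_PiM)

lemma atLeastAtMost_Suc_insert: "{1..Suc m} = insert (Suc m) {1..m}"
  by auto

lemma emeasure_lborel_translate:
  fixes A :: "real set"
  assumes "A \<in> sets borel"
  shows "emeasure lborel {y. s + y \<in> A} = emeasure lborel A"
proof -
  have "emeasure lborel A = emeasure (distr lborel borel ((+) s)) A"
    by (simp add: lborel_distr_plus)
  also have "\<dots> = emeasure lborel {y. s + y \<in> A}"
    using assms by (subst emeasure_distr) (auto simp: vimage_def)
  finally show ?thesis by simp
qed

lemma measurable_anchor [measurable]:
  "i \<le> m \<Longrightarrow> (\<lambda>y. anchor y i) \<in> borel_measurable (lborel_pow m)"
  unfolding anchor_def by (cases "i = 0") simp_all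

lemma measurable_partial_sum:
  "i \<le> m \<Longrightarrow> (\<lambda>x. \<Sum>k = 1..i. x k) \<in> borel_measurable (lborel_pow m)"
  by (intro borel_measurable_sum measurable_compose[OF measurable_component_singleton]) auto

lemma measurable_psum: "psum m \<in> lborel_pow m \<rightarrow>\<^sub>M lborel_pow m"
  unfolding psum_def using measurable_partial_sum
  by (intro measurable_restrict) auto

text \<open>Fubini with the last coordinate integrated first: once the others are fixed, the last
  partial sum is a translate of it, so the inner integral contributes a constant factor.\<close>

lemma nn_integral_partial_sums_indicator:
  assumes "\<And>i. i \<in> {1..m} \<Longrightarrow> A i \<in> sets borel"
  shows "(\<integral>\<^sup>+ x. (\<Prod>i = 1..m. indicator (A i) (\<Sum>k = 1..i. x k)) \<partial>lborel_pow m)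
           = (\<Prod>i = 1..m. emeasure lborel (A i))"
  using assms
proof (induction m)
  case 0
  show ?case by (simp add: PiM_empty nn_integral_count_space_finite)
next
  case (Suc m)
  have meas: "(\<lambda>x. indicator (A i) (\<Sum>k = 1..i. x k) :: ennreal) \<in> borel_measurable (lborel_pow p)"
    if "i \<in> {1..Suc m}" "i \<le> p" for i p
    using Suc.prems[OF that(1)] by (intro measurable_compose[OF measurable_partial_sum[OF that(2)]]) auto
  have "(\<integral>\<^sup>+ x. (\<Prod>i = 1..Suc m. indicator (A i) (\<Sum>k = 1..i. x k)) \<partial>lborel_pow (Suc m)) =
        (\<integral>\<^sup>+ x. (\<integral>\<^sup>+ y. (\<Prod>i = 1..Suc m. indicator (A i) (\<Sum>k = 1..i. (x(Suc m := y)) k)) \<partial>lborel)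
            \<partial>lborel_pow m)"
    unfolding atLeastAtMost_Suc_insert
  proof (subst lborel_product.product_nn_integral_insert)
    show "(\<lambda>x. \<Prod>i\<in>insert (Suc m) {1..m}. indicator (A i) (\<Sum>k = 1..i. x k) :: ennreal)
          \<in> borel_measurable (Pi\<^sub>M (insert (Suc m) {1..m}) (\<lambda>_. lborel))"
      unfolding atLeastAtMost_Suc_insert[symmetric]
      by (intro borel_measurable_prod_ennreal meas) auto
  qed auto
  also have "\<dots> = (\<integral>\<^sup>+ x. (\<Prod>i = 1..m. indicator (A i) (\<Sum>k = 1..i. x k)) * emeasure lborel (A (Suc m)) \<partial>lborel_pow m)"
  proof (intro nn_integral_cong)
    fix x :: "nat \<Rightarrow> real"
    have eq: "(\<Sum>k = 1..i. (x(Suc m := y)) k) = (\<Sum>k = 1..i. x k)" if "i \<in> {1..m}" for i y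
      using that by (intro sum.cong) auto
    have S: "(\<Sum>k = 1..Suc m. (x(Suc m := y)) k) = (\<Sum>k = 1..m. x k) + y" for y
      by (simp add: sum.cl_ivl_Suc)
    have P: "(\<Prod>i = 1..m. indicator (A i) (\<Sum>k = 1..i. (x(Suc m := y)) k) :: ennreal)
        = (\<Prod>i = 1..m. indicator (A i) (\<Sum>k = 1..i. x k))" for y
      using eq by (intro prod.cong) (auto simp del: fun_upd_apply)
    have "(\<Prod>i = 1..Suc m. indicator (A i) (\<Sum>k = 1..i. (x(Suc m := y)) k) :: ennreal)
        = (\<Prod>i = 1..m. indicator (A i) (\<Sum>k = 1..i. x k)) * indicator {y. (\<Sum>k = 1..m. x k) + y \<in> A (Suc m)} y" for y
      unfolding prod.cl_ivl_Suc P S by (simp add: indicator_def)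
    then have "(\<integral>\<^sup>+ y. (\<Prod>i = 1..Suc m. indicator (A i) (\<Sum>k = 1..i. (x(Suc m := y)) k)) \<partial>lborel)
        = (\<integral>\<^sup>+ y. (\<Prod>i = 1..m. indicator (A i) (\<Sum>k = 1..i. x k)) * indicator {y. (\<Sum>k = 1..m. x k) + y \<in> A (Suc m)} y \<partial>lborel)"
      by simp
    also have "\<dots> = (\<Prod>i = 1..m. indicator (A i) (\<Sum>k = 1..i. x k)) * emeasure lborel {y. (\<Sum>k = 1..m. x k) + y \<in> A (Suc m)}"
    proof (rule nn_integral_cmult_indicator)
      have [measurable]: "A (Suc m) \<in> sets borel" using Suc.prems by auto
      show "{y. (\<Sum>k = 1..m. x k) + y \<in> A (Suc m)} \<in> sets lborel" by measurable
    qed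
    finally show "(\<integral>\<^sup>+ y. (\<Prod>i = 1..Suc m. indicator (A i) (\<Sum>k = 1..i. (x(Suc m := y)) k)) \<partial>lborel)
        = (\<Prod>i = 1..m. indicator (A i) (\<Sum>k = 1..i. x k)) * emeasure lborel (A (Suc m))"
      using Suc.prems by (simp add: emeasure_lborel_translate)
  qed
  also have "\<dots> = (\<integral>\<^sup>+ x. (\<Prod>i = 1..m. indicator (A i) (\<Sum>k = 1..i. x k)) \<partial>lborel_pow m) * emeasure lborel (A (Suc m))"
    by (intro nn_integral_multc borel_measurable_prod_ennreal meas) auto
  also have "\<dots> = (\<Prod>i = 1..Suc m. emeasure lborel (A i))"
    using Suc by simp
  finally show ?case .
qed

text \<open>A product measure is determined on boxes, and the indicator of the preimage of a box is
  the integrand of the preceding lemma.\<close>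

lemma distr_psum: "distr (lborel_pow m) (lborel_pow m) (psum m) = lborel_pow m"
proof (rule lborel_product.PiM_eqI)
  fix A :: "nat \<Rightarrow> real set"
  assume A: "\<And>i. i \<in> {1..m} \<Longrightarrow> A i \<in> sets lborel"
  have A': "Pi\<^sub>E {1..m} A \<in> sets (lborel_pow m)"
    using A by (intro sets_PiM_I_finite) auto
  have "emeasure (distr (lborel_pow m) (lborel_pow m) (psum m)) (Pi\<^sub>E {1..m} A)
      = emeasure (lborel_pow m) (psum m -` Pi\<^sub>E {1..m} A \<inter> space (lborel_pow m))"
    using A' by (rule emeasure_distr[OF measurable_psum])
  also have "\<dots> = (\<integral>\<^sup>+ x. indicator (psum m -` Pi\<^sub>E {1..m} A \<inter> space (lborel_pow m)) x \<partial>lborel_pow m)"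
    using A' by (intro nn_integral_indicator[symmetric] measurable_sets[OF measurable_psum])
  also have "\<dots> = (\<integral>\<^sup>+ x. (\<Prod>i = 1..m. indicator (A i) (\<Sum>k = 1..i. x k)) \<partial>lborel_pow m)"
  proof (intro nn_integral_cong)
    fix x assume "x \<in> space (lborel_pow m)"
    then show "indicator (psum m -` Pi\<^sub>E {1..m} A \<inter> space (lborel_pow m)) x
        = (\<Prod>i = 1..m. indicator (A i) (\<Sum>k = 1..i. x k) :: ennreal)"
      by (cases "\<forall>i\<in>{1..m}. (\<Sum>k = 1..i. x k) \<in> A i")
         (auto simp: psum_def indicator_def PiE_iff prod_zero_iff intro!: prod.neutral)
  qed
  also have "\<dots> = (\<Prod>i = 1..m. emeasure lborel (A i))"
    using A by (intro nn_integral_partial_sums_indicator) auto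
  finally show "emeasure (distr (lborel_pow m) (lborel_pow m) (psum m)) (Pi\<^sub>E {1..m} A)
      = (\<Prod>i\<in>{1..m}. emeasure lborel (A i))" .
qed auto

text \<open>The change of coordinates that carries a + \<open>nabla m w\<close> to
  \<open>nabla m id\<close>, so that all cells can be compared with one simplex.\<close>

definition perm_shift :: "nat \<Rightarrow> (nat \<Rightarrow> nat) \<Rightarrow> (nat \<Rightarrow> real) \<Rightarrow> (nat \<Rightarrow> real) \<Rightarrow> nat \<Rightarrow> real" where
  "perm_shift m w a y = (\<lambda>i\<in>{1..m}. y (w i) - a (w i))"

lemma measurable_perm_shift:
  assumes "w permutes {1..m}"
  shows "perm_shift m w a \<in> lborel_pow m \<rightarrow>\<^sub>M lborel_pow m"
  unfolding perm_shift_def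
proof (intro measurable_restrict)
  fix i assume "i \<in> {1..m}"
  then have wi: "w i \<in> {1..m}" using permutes_in_image[OF assms] by blast
  have "(\<lambda>y. y (w i)) \<in> lborel_pow m \<rightarrow>\<^sub>M (lborel :: real measure)"
    using wi by (rule measurable_component_singleton)
  then show "(\<lambda>y. y (w i) - a (w i)) \<in> lborel_pow m \<rightarrow>\<^sub>M lborel"
    by simp
qed

lemma distr_perm_shift:
  assumes w: "w permutes {1..m}"
  shows "distr (lborel_pow m) (lborel_pow m) (perm_shift m w a) = lborel_pow m"
proof (rule lborel_product.PiM_eqI)
  fix A :: "nat \<Rightarrow> real set"
  assume A: "\<And>i. i \<in> {1..m} \<Longrightarrow> A i \<in> sets lborel"
  \<comment> \<open>The preimage of a box is a box with its sides permuted and translated; the form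
    \<open>- a j + y\<close> matches \<open>emeasure_lborel_translate\<close>.\<close>
  let ?B = "\<lambda>j. {y. - a j + y \<in> A (inv w j)}"
  have inv_in: "inv w j \<in> {1..m}" if "j \<in> {1..m}" for j
    using that permutes_in_image[OF permutes_inv[OF w]] by blast
  have w_in: "w j \<in> {1..m}" if "j \<in> {1..m}" for j
    using that permutes_in_image[OF w] by blast
  have B: "?B j \<in> sets lborel" if "j \<in> {1..m}" for j
  proof -
    have [measurable]: "A (inv w j) \<in> sets borel" using A inv_in[OF that] by simp
    show ?thesis by measurable
  qed
  have pre: "perm_shift m w a -` Pi\<^sub>E {1..m} A \<inter> space (lborel_pow m) = Pi\<^sub>E {1..m} ?B"
  proof (intro set_eqI iffI)
    fix y assume "y \<in> perm_shift m w a -` Pi\<^sub>E {1..m} A \<inter> space (lborel_pow m)"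
    then have ye: "y \<in> rpoints m" and yA: "perm_shift m w a y \<in> Pi\<^sub>E {1..m} A"
      unfolding space_lborel_pow by auto
    have y: "perm_shift m w a y i \<in> A i" if "i \<in> {1..m}" for i
      using PiE_mem[OF yA that] .
    have "y j \<in> ?B j" if "j \<in> {1..m}" for j
      using y[OF inv_in[OF that]] inv_in[OF that] permutes_inverses(1)[OF w]
      by (simp add: perm_shift_def)
    then show "y \<in> Pi\<^sub>E {1..m} ?B"
      using ye by (auto simp: PiE_iff)
  next
    fix y assume y: "y \<in> Pi\<^sub>E {1..m} ?B"
    have "y (w i) - a (w i) \<in> A i" if "i \<in> {1..m}" for i
      using PiE_mem[OF y w_in[OF that]] permutes_inverses(2)[OF w] by simp
    then show "y \<in> perm_shift m w a -` Pi\<^sub>E {1..m} A \<inter> space (lborel_pow m)"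
      using y unfolding space_lborel_pow perm_shift_def by (auto simp: PiE_iff)
  qed
  have "emeasure (distr (lborel_pow m) (lborel_pow m) (perm_shift m w a)) (Pi\<^sub>E {1..m} A)
      = emeasure (lborel_pow m) (Pi\<^sub>E {1..m} ?B)"
    unfolding pre[symmetric] using A
    by (intro emeasure_distr[OF measurable_perm_shift[OF w]] sets_PiM_I_finite) auto
  also have "\<dots> = (\<Prod>j\<in>{1..m}. emeasure lborel (?B j))"
    using B by (intro lborel_product.emeasure_PiM) auto
  also have "\<dots> = (\<Prod>j\<in>{1..m}. emeasure lborel (A (inv w j)))"
  proof (intro prod.cong refl)
    fix j assume "j \<in> {1..m}"
    then show "emeasure lborel (?B j) = emeasure lborel (A (inv w j))"
      using A inv_in by (intro emeasure_lborel_translate) auto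
  qed
  also have "\<dots> = (\<Prod>i\<in>{1..m}. emeasure lborel (A i))"
    using prod.permute[OF permutes_inv[OF w], of "\<lambda>i. emeasure lborel (A i)"] by (simp add: comp_def)
  finally show "emeasure (distr (lborel_pow m) (lborel_pow m) (perm_shift m w a)) (Pi\<^sub>E {1..m} A)
      = (\<Prod>i\<in>{1..m}. emeasure lborel (A i))" .
qed auto

section \<open>Null sets where a coordinate difference is an integer\<close>

text \<open>Integrating over coordinate j first, at most one value of y_j satisfies the equation for
  given other coordinates.\<close>

lemma AE_anchor_diff_neq:
  assumes "i < j" "j \<le> m"
  shows "AE y in lborel_pow m. anchor y j - anchor y i \<noteq> r"
proof -
  let ?I = "{1..m} - {j}"
  let ?N = "{y \<in> space (lborel_pow m). anchor y j - anchor y i = r}"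
  have I: "{1..m} = insert j ?I" using assms by auto
  have [measurable]: "(\<lambda>y. anchor y i) \<in> borel_measurable (lborel_pow m)"
    "(\<lambda>y. anchor y j) \<in> borel_measurable (lborel_pow m)"
    using assms by (auto intro!: measurable_anchor simp del: One_nat_def)
  have N: "?N \<in> sets (lborel_pow m)" by measurable
  have "emeasure (lborel_pow m) ?N = (\<integral>\<^sup>+ y. indicator ?N y \<partial>lborel_pow m)"
    using N by simp
  also have "\<dots> = (\<integral>\<^sup>+ x. (\<integral>\<^sup>+ y. indicator ?N (x(j := y)) \<partial>lborel) \<partial>Pi\<^sub>M ?I (\<lambda>_. lborel))"
    using lborel_product.product_nn_integral_insert[of ?I j "indicator ?N"] N I by simp
  also have "\<dots> = (\<integral>\<^sup>+ x. 0 \<partial>Pi\<^sub>M ?I (\<lambda>_. lborel :: real measure))"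
  proof (intro nn_integral_cong)
    fix x :: "nat \<Rightarrow> real"
    have "(\<integral>\<^sup>+ y. indicator ?N (x(j := y)) \<partial>lborel) \<le> (\<integral>\<^sup>+ y. indicator {r + anchor x i} y \<partial>lborel)"
      using assms by (intro nn_integral_mono) (auto simp: indicator_def anchor_def split: if_splits)
    also have "\<dots> = 0" by (subst nn_integral_indicator) auto
    finally show "(\<integral>\<^sup>+ y. indicator ?N (x(j := y)) \<partial>lborel) = 0" by simp
  qed
  finally have "emeasure (lborel_pow m) ?N = 0" by simp
  then show ?thesis using N by (intro AE_I[where N = ?N]) auto
qed

lemma AE_anchor_diff_notin_Ints:
  "AE y in lborel_pow m. \<forall>i j. i < j \<and> j \<le> m \<longrightarrow> anchor y j - anchor y i \<notin> \<int>"
proof -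
  have "AE y in lborel_pow m. \<forall>(i, j, k :: int)\<in>{(i, j, k). i < j \<and> j \<le> m}. anchor y j - anchor y i \<noteq> of_int k"
    by (subst AE_ball_countable) (auto intro: AE_anchor_diff_neq)
  then show ?thesis by eventually_elim (fastforce simp: Ints_def)
qed

section \<open>The open simplices \<open>nabla m w\<close> and the order of coordinates\<close>

lemma inv_permutes_mem: "w permutes {1..m :: nat} \<Longrightarrow> i \<in> {1..m} \<Longrightarrow> inv w i \<in> {1..m}"
  by (simp only: permutes_in_image[OF permutes_inv])

lemma inv_permutes_0: "w permutes {1..m :: nat} \<Longrightarrow> inv w 0 = 0"
  by (rule permutes_not_in[OF permutes_inv]) auto

text \<open>Rephrased through \<open>inv w\<close>, the position of a coordinate in the increasing
  chain, because descents and the differences y_j - y_i refer to coordinates rather than to chain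
  positions.\<close>

lemma nabla_iff:
  assumes w: "w permutes {1..m}"
  shows "y \<in> nabla m w \<longleftrightarrow> y \<in> rpoints m \<and> (\<forall>i\<in>{1..m}. 0 < y i \<and> y i < 1) \<and>
    (\<forall>i\<in>{1..m}. \<forall>j\<in>{1..m}. inv w i < inv w j \<longrightarrow> y i < y j)"
proof -
  have w_in: "w j \<in> {1..m}" if "j \<in> {1..m}" for j
    using that permutes_in_image[OF w] by blast
  have "sorted_wrt (\<lambda>p q. y (w p) < y (w q)) [1..<m + 1] \<longleftrightarrow>
      (\<forall>p q. p < q \<longrightarrow> q < m \<longrightarrow> y (w (1 + p)) < y (w (1 + q)))"
    unfolding sorted_wrt_iff_nth_less by (auto simp del: One_nat_def upt_Suc)
  also have "\<dots> \<longleftrightarrow> (\<forall>p\<in>{1..m}. \<forall>q\<in>{1..m}. p < q \<longrightarrow> y (w p) < y (w q))"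
  proof
    assume *: "\<forall>p q. p < q \<longrightarrow> q < m \<longrightarrow> y (w (1 + p)) < y (w (1 + q))"
    show "\<forall>p\<in>{1..m}. \<forall>q\<in>{1..m}. p < q \<longrightarrow> y (w p) < y (w q)"
    proof (intro ballI impI)
      fix p q assume "p \<in> {1..m}" "q \<in> {1..m}" "p < q"
      then show "y (w p) < y (w q)" using *[rule_format, of "p - 1" "q - 1"] by auto
    qed
  qed auto
  also have "\<dots> \<longleftrightarrow> (\<forall>i\<in>{1..m}. \<forall>j\<in>{1..m}. inv w i < inv w j \<longrightarrow> y i < y j)"
  proof
    assume *: "\<forall>p\<in>{1..m}. \<forall>q\<in>{1..m}. p < q \<longrightarrow> y (w p) < y (w q)"
    show "\<forall>i\<in>{1..m}. \<forall>j\<in>{1..m}. inv w i < inv w j \<longrightarrow> y i < y j"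
    proof (intro ballI impI)
      fix i j assume ij: "i \<in> {1..m}" "j \<in> {1..m}" "inv w i < inv w j"
      then have "y (w (inv w i)) < y (w (inv w j))" using * inv_permutes_mem[OF w] by blast
      then show "y i < y j" unfolding permutes_inverses(1)[OF w] .
    qed
  next
    assume *: "\<forall>i\<in>{1..m}. \<forall>j\<in>{1..m}. inv w i < inv w j \<longrightarrow> y i < y j"
    show "\<forall>p\<in>{1..m}. \<forall>q\<in>{1..m}. p < q \<longrightarrow> y (w p) < y (w q)"
    proof (intro ballI impI)
      fix p q assume "p \<in> {1..m}" "q \<in> {1..m}" "p < q"
      moreover from \<open>p < q\<close> have "inv w (w p) < inv w (w q)" unfolding permutes_inverses(2)[OF w] .
      ultimately show "y (w p) < y (w q)" using * w_in by blast
    qed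
  qed
  finally have s: "sorted_wrt (\<lambda>p q. y (w p) < y (w q)) [1..<m + 1] \<longleftrightarrow>
      (\<forall>i\<in>{1..m}. \<forall>j\<in>{1..m}. inv w i < inv w j \<longrightarrow> y i < y j)" .
  have "{1..<m + 1} = {1..m}" by auto
  then have im: "(\<lambda>p. y (w p)) ` {1..<m + 1} = y ` {1..m}"
    using permutes_image[OF w] by (metis image_image)
  have b0: "(\<forall>p\<in>{1..<m + 1}. 0 < y (w p)) \<longleftrightarrow> (\<forall>i\<in>{1..m}. 0 < y i)"
    using arg_cong[OF im, of "\<lambda>S. \<forall>v\<in>S. 0 < v"] by (simp only: ball_simps)
  have b1: "(\<forall>p\<in>{1..<m + 1}. y (w p) < 1) \<longleftrightarrow> (\<forall>i\<in>{1..m}. y i < 1)"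
    using arg_cong[OF im, of "\<lambda>S. \<forall>v\<in>S. v < 1"] by (simp only: ball_simps)
  have "sorted_wrt (<) ([0] @ map (\<lambda>i. y (w i)) [1..<m + 1] @ [1]) \<longleftrightarrow>
      sorted_wrt (\<lambda>p q. y (w p) < y (w q)) [1..<m + 1] \<and>
      (\<forall>p\<in>{1..<m + 1}. 0 < y (w p)) \<and> (\<forall>p\<in>{1..<m + 1}. y (w p) < 1)"
    by (auto simp: sorted_wrt_append sorted_wrt_map simp del: One_nat_def upt_Suc)
  then show ?thesis
    unfolding nabla_def s b0 b1 by blast
qed

lemma nabla_subset_rpoints: "nabla m w \<subseteq> rpoints m"
  by (auto simp: nabla_def)

lemma nabla_anchor_bounds:
  assumes w: "w permutes {1..m}" and y: "y \<in> nabla m w" and "i \<le> m"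
  shows "0 \<le> anchor y i" "anchor y i < 1"
proof -
  have "0 < y i \<and> y i < 1" if "i \<noteq> 0"
    using y assms(3) that unfolding nabla_iff[OF w] by simp
  then show "0 \<le> anchor y i" "anchor y i < 1"
    by (auto simp: anchor_def)
qed

text \<open>Index 0 joins the same order: its position \<open>inv w 0 = 0\<close> and its anchored
  value 0 are both smallest.\<close>

lemma nabla_anchor_less:
  assumes w: "w permutes {1..m}" and y: "y \<in> nabla m w" and ij: "i \<le> m" "j \<le> m" "inv w i < inv w j"
  shows "anchor y i < anchor y j"
proof -
  have "j \<noteq> 0" using ij inv_permutes_0[OF w] by (cases j) auto
  with ij y show ?thesis unfolding nabla_iff[OF w] anchor_def by (cases "i = 0") auto
qed

text \<open>Anchored coordinates lie in [0, 1), so differences have absolute value below 1, and the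
  positions fix their sign. The \<open>of_bool\<close> term merges the cases (0, 1) and (-1,
  0).\<close>

lemma nabla_anchor_diff_bounds:
  assumes w: "w permutes {1..m}" and y: "y \<in> nabla m w" and ij: "i \<le> m" "j \<le> m" "i \<noteq> j"
  shows "of_bool (inv w i < inv w j) - 1 < anchor y j - anchor y i"
    "anchor y j - anchor y i < of_bool (inv w i < inv w j)"
proof -
  have "inv w i \<noteq> inv w j" using ij permutes_inj[OF permutes_inv[OF w]] by (auto dest: injD)
  then consider "inv w i < inv w j" | "\<not> inv w i < inv w j" "inv w j < inv w i" by linarith
  then have "of_bool (inv w i < inv w j) - 1 < anchor y j - anchor y i \<and>
      anchor y j - anchor y i < of_bool (inv w i < inv w j)"
  proof cases
    case 1
    have "anchor y i < anchor y j" by (rule nabla_anchor_less[OF w y ij(1,2) 1])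
    moreover have "anchor y j < 1" "0 \<le> anchor y i" using nabla_anchor_bounds[OF w y] ij by blast+
    ultimately show ?thesis using 1 by simp
  next
    case 2
    have "anchor y j < anchor y i" by (rule nabla_anchor_less[OF w y ij(2,1) 2(2)])
    moreover have "anchor y i < 1" "0 \<le> anchor y j" using nabla_anchor_bounds[OF w y] ij by blast+
    ultimately show ?thesis using 2 by simp
  qed
  then show "of_bool (inv w i < inv w j) - 1 < anchor y j - anchor y i"
    "anchor y j - anchor y i < of_bool (inv w i < inv w j)" by blast+
qed

lemma nabla_nonempty:
  assumes w: "w permutes {1..m}"
  shows "nabla m w \<noteq> {}"
proof -
  \<comment> \<open>Equally spaced values: each coordinate is its position divided by m + 1.\<close>
  let ?t = "\<lambda>i\<in>{1..m}. real (inv w i) / real (m + 1)"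
  have "0 < ?t i \<and> ?t i < 1" if "i \<in> {1..m}" for i
    using inv_permutes_mem[OF w that] that by (simp add: divide_simps)
  moreover have "?t i < ?t j" if "i \<in> {1..m}" "j \<in> {1..m}" "inv w i < inv w j" for i j
    using that by (simp add: divide_strict_right_mono)
  moreover have "?t \<in> rpoints m" by (rule restrict_PiE_iff[THEN iffD2]) simp
  ultimately have "?t \<in> nabla m w" unfolding nabla_iff[OF w] by blast
  then show ?thesis by (rule ex_in_conv[THEN iffD1, OF exI])
qed

text \<open>The coordinates not exceeding y_i are those in the first \<open>inv w i\<close>
  positions of the chain. Hence a single point of the simplex determines w.\<close>

lemma inv_eq_rank:
  assumes w: "w permutes {1..m}" and y: "y \<in> nabla m w" and i: "i \<in> {1..m}"
  shows "inv w i = card {j\<in>{1..m}. y j \<le> y i}"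
proof -
  have less: "y j < y k" if "inv w j < inv w k" "j \<in> {1..m}" "k \<in> {1..m}" for j k
    using that y unfolding nabla_iff[OF w] by blast
  have "{j\<in>{1..m}. y j \<le> y i} = {j\<in>{1..m}. inv w j \<le> inv w i}"
  proof (intro Collect_cong conj_cong refl)
    fix j assume j: "j \<in> {1..m}"
    show "y j \<le> y i \<longleftrightarrow> inv w j \<le> inv w i"
      using less[of j i] less[of i j] i j injD[OF permutes_inj[OF permutes_inv[OF w]], of i j]
      by (metis le_less not_less)
  qed
  also have "\<dots> = w ` {1..inv w i}"
  proof (intro set_eqI iffI)
    fix j assume "j \<in> {j\<in>{1..m}. inv w j \<le> inv w i}"
    then have "inv w j \<in> {1..inv w i}" using inv_permutes_mem[OF w, of j] by auto
    then show "j \<in> w ` {1..inv w i}" using permutes_inverses(1)[OF w] by (metis image_eqI)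
  next
    fix j assume "j \<in> w ` {1..inv w i}"
    then obtain p where p: "p \<in> {1..inv w i}" "j = w p" by blast
    have "p \<in> {1..m}" using p inv_permutes_mem[OF w i] by auto
    then have "j \<in> {1..m}" using p permutes_in_image[OF w] by blast
    then show "j \<in> {j\<in>{1..m}. inv w j \<le> inv w i}" using p permutes_inverses(2)[OF w] by auto
  qed
  also have "card \<dots> = inv w i"
    by (subst card_image[OF permutes_inj_on[OF w]]) simp
  finally show ?thesis by (rule sym)
qed

lemma nabla_unique:
  assumes w: "w permutes {1..m}" "w' permutes {1..m}" and y: "y \<in> nabla m w" "y \<in> nabla m w'"
  shows "w = w'"
proof -
  have "inv w i = inv w' i" for i
  proof (cases "i \<in> {1..m}")
    case True
    show ?thesis
      unfolding inv_eq_rank[OF w(1) y(1) True] inv_eq_rank[OF w(2) y(2) True] ..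
  next
    case False
    show ?thesis
      unfolding permutes_not_in[OF permutes_inv[OF w(1)] False]
        permutes_not_in[OF permutes_inv[OF w(2)] False] ..
  qed
  then have "inv w = inv w'" by (rule ext)
  then have "inv (inv w) = inv (inv w')" by (rule arg_cong)
  then show ?thesis unfolding permutes_inv_inv[OF w(1)] permutes_inv_inv[OF w(2)] .
qed

lemma nabla_exists:
  assumes y: "y \<in> rpoints m" and pos: "\<And>i. i \<in> {1..m} \<Longrightarrow> 0 < y i \<and> y i < 1"
    and inj: "inj_on y {1..m}"
  shows "\<exists>w. w permutes {1..m} \<and> y \<in> nabla m w"
proof -
  \<comment> \<open>The rank of y_i, extended by the identity outside {1..m}. By
    \<open>inv_eq_rank\<close> the permutation sought can only be its inverse.\<close>
  define r where "r i = (if i \<in> {1..m} then card {j\<in>{1..m}. y j \<le> y i} else i)" for i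
  have r_less: "r i < r j" if "y i < y j" "i \<in> {1..m}" "j \<in> {1..m}" for i j
  proof -
    have "{k\<in>{1..m}. y k \<le> y i} \<subset> {k\<in>{1..m}. y k \<le> y j}"
    proof
      show "{k\<in>{1..m}. y k \<le> y i} \<subseteq> {k\<in>{1..m}. y k \<le> y j}" using that by auto
      have "j \<in> {k\<in>{1..m}. y k \<le> y j}" "j \<notin> {k\<in>{1..m}. y k \<le> y i}" using that by auto
      then show "{k\<in>{1..m}. y k \<le> y i} \<noteq> {k\<in>{1..m}. y k \<le> y j}" by blast
    qed
    then have "card {k\<in>{1..m}. y k \<le> y i} < card {k\<in>{1..m}. y k \<le> y j}"
      by (intro psubset_card_mono) auto
    then show ?thesis using that by (simp add: r_def del: atLeastAtMost_iff)
  qed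
  have r_iff: "r i < r j \<longleftrightarrow> y i < y j" if "i \<in> {1..m}" "j \<in> {1..m}" for i j
  proof (cases "y i = y j")
    case True
    then have "i = j" using inj that by (meson inj_onD)
    then show ?thesis by simp
  next
    case False
    then show ?thesis using r_less[of i j] r_less[of j i] that by fastforce
  qed
  have r: "r permutes {1..m}"
  proof (rule inj_imp_permutes)
    show "inj_on r {1..m}"
    proof (rule inj_onI)
      fix i j assume "i \<in> {1..m}" "j \<in> {1..m}" "r i = r j"
      then have "y i = y j" using r_iff[of i j] r_iff[of j i] by auto
      then show "i = j" using inj_onD[OF inj] \<open>i \<in> {1..m}\<close> \<open>j \<in> {1..m}\<close> by blast
    qed
    fix i assume i: "i \<in> {1..m}"
    have "card {j\<in>{1..m}. y j \<le> y i} \<le> card {1..m}" by (intro card_mono) auto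
    moreover have "card {j\<in>{1..m}. y j \<le> y i} > 0" using i by (subst card_gt_0_iff) auto
    ultimately show "r i \<in> {1..m}" using i by (auto simp: r_def)
  qed (auto simp: r_def)
  have "y \<in> nabla m (inv r)"
    unfolding nabla_iff[OF permutes_inv[OF r]] permutes_inv_inv[OF r]
    using y pos r_iff by blast
  then show ?thesis using permutes_inv[OF r] by blast
qed

section \<open>Lattice translates of the simplices and their volume\<close>

text \<open>The set a + \<open>nabla m w\<close>. Only the values of a on {1..m} matter, so a need
  not be extensional; later it is also a descent-counting function.\<close>

definition cell :: "nat \<Rightarrow> (nat \<Rightarrow> real) \<Rightarrow> (nat \<Rightarrow> nat) \<Rightarrow> (nat \<Rightarrow> real) set" where
  "cell m a w = {y \<in> rpoints m. (\<lambda>i\<in>{1..m}. y i - a i) \<in> nabla m w}"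

text \<open>Reduces measurability and volume of every cell to those of the single simplex
  \<open>nabla m id\<close>.\<close>

lemma cell_eq_vimage:
  assumes w: "w permutes {1..m}"
  shows "cell m a w = perm_shift m w a -` nabla m id \<inter> space (lborel_pow m)"
proof -
  have eq: "map (\<lambda>i. perm_shift m w a y (id i)) [1..<m + 1]
      = map (\<lambda>i. (\<lambda>i\<in>{1..m}. y i - a i) (w i)) [1..<m + 1]" for y
  proof (intro map_cong refl)
    fix i assume "i \<in> set [1..<m + 1]"
    then have i: "i \<in> {1..m}" by auto
    then have "w i \<in> {1..m}" using permutes_in_image[OF w] by blast
    then show "perm_shift m w a y (id i) = (\<lambda>i\<in>{1..m}. y i - a i) (w i)"
      using i by (simp add: perm_shift_def)
  qed
  have "perm_shift m w a y \<in> nabla m id \<longleftrightarrow> (\<lambda>i\<in>{1..m}. y i - a i) \<in> nabla m w" for y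
    unfolding nabla_def mem_Collect_eq eq by (simp add: perm_shift_def restrict_PiE_iff del: One_nat_def upt_Suc)
  then show ?thesis
    unfolding cell_def space_lborel_pow by blast
qed

lemma sets_nabla_id: "nabla m id \<in> sets (lborel_pow m)"
proof -
  have comp: "(\<lambda>y. y i) \<in> borel_measurable (lborel_pow m)" if "i \<in> {1..m}" for i
    using measurable_component_singleton[OF that, of "\<lambda>_. lborel :: real measure"] by simp
  have "nabla m id = {y \<in> space (lborel_pow m). (\<forall>i\<in>{1..m}. 0 < y i \<and> y i < 1) \<and>
      (\<forall>i\<in>{1..m}. \<forall>j\<in>{1..m}. i < j \<longrightarrow> y i < y j)}"
    unfolding space_lborel_pow
    by (rule set_eqI) (simp only: nabla_iff[OF permutes_id] inv_id id_apply mem_Collect_eq)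
  also have "\<dots> \<in> sets (lborel_pow m)"
  proof (rule sets.sets_Collect_conj; rule sets.sets_Collect_finite_All)
    fix i assume i: "i \<in> {1..m}"
    show "{y \<in> space (lborel_pow m). 0 < y i \<and> y i < 1} \<in> sets (lborel_pow m)"
      by (intro sets.sets_Collect_conj borel_measurable_less borel_measurable_const comp[OF i])
    show "{y \<in> space (lborel_pow m). \<forall>j\<in>{1..m}. i < j \<longrightarrow> y i < y j} \<in> sets (lborel_pow m)"
    proof (rule sets.sets_Collect_finite_All)
      fix j assume j: "j \<in> {1..m}"
      show "{y \<in> space (lborel_pow m). i < j \<longrightarrow> y i < y j} \<in> sets (lborel_pow m)"
        using borel_measurable_less[OF comp[OF i] comp[OF j]] by (cases "i < j") simp_all
    qed simp
  qed simp_all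
  finally show ?thesis .
qed

lemma sets_cell: "w permutes {1..m} \<Longrightarrow> cell m a w \<in> sets (lborel_pow m)"
  unfolding cell_eq_vimage by (intro measurable_sets[OF measurable_perm_shift] sets_nabla_id)

lemma emeasure_cell:
  assumes w: "w permutes {1..m}"
  shows "emeasure (lborel_pow m) (cell m a w) = emeasure (lborel_pow m) (nabla m id)"
  unfolding cell_eq_vimage[OF w]
  using emeasure_distr[OF measurable_perm_shift[OF w] sets_nabla_id, of a] distr_perm_shift[OF w, of a]
  by simp

lemma emeasure_unit_cube: "emeasure (lborel_pow m) ({1..m} \<rightarrow>\<^sub>E {0<..<1}) = 1"
  by (subst lborel_product.emeasure_PiM) auto

lemma emeasure_nabla_id_finite: "emeasure (lborel_pow m) (nabla m id) \<noteq> \<infinity>"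
proof -
  have "nabla m id \<subseteq> {1..m} \<rightarrow>\<^sub>E {0<..<1}"
    unfolding subset_iff nabla_iff[OF permutes_id] by (simp add: PiE_iff)
  then have "emeasure (lborel_pow m) (nabla m id) \<le> emeasure (lborel_pow m) ({1..m} \<rightarrow>\<^sub>E {0<..<1})"
    by (intro emeasure_mono sets_PiM_I_finite) auto
  then show ?thesis unfolding emeasure_unit_cube by (auto simp: top_unique)
qed

text \<open>Both y - a and y - a' lie in the open unit cube, so the integers a_i - a'_i have
  absolute value below 1. Then \<open>nabla_unique\<close> identifies the permutations.\<close>

lemma cell_unique:
  assumes w: "w permutes {1..m}" "w' permutes {1..m}"
    and a: "a \<in> lattice_points m" "a' \<in> lattice_points m"
    and y: "y \<in> cell m a w" "y \<in> cell m a' w'"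
  shows "a = a'" "w = w'"
proof -
  show aa: "a = a'"
  proof (rule PiE_ext[OF a])
    fix i assume i: "i \<in> {1..m}"
    have "0 < y i - a i \<and> y i - a i < 1" "0 < y i - a' i \<and> y i - a' i < 1"
      using y i unfolding cell_def nabla_iff[OF w(1)] nabla_iff[OF w(2)] by auto
    moreover have "a i - a' i \<in> \<int>" using a i by (auto simp: PiE_iff)
    ultimately have "\<bar>a i - a' i\<bar> < 1" by auto
    then show "a i = a' i" using \<open>a i - a' i \<in> \<int>\<close> Ints_nonzero_abs_less1[of "a i - a' i"] by simp
  qed
  show "w = w'" using y aa unfolding cell_def by (auto intro: nabla_unique[OF w])
qed

lemma cell_exists:
  assumes y: "y \<in> rpoints m" and gen: "\<And>i j. i < j \<Longrightarrow> j \<le> m \<Longrightarrow> anchor y j - anchor y i \<notin> \<int>"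
  shows "\<exists>a w. a \<in> lattice_points m \<and> w permutes {1..m} \<and> y \<in> cell m a w"
proof -
  \<comment> \<open>Integer parts give the lattice point, fractional parts the point of the simplex.
    The assumption \<open>gen\<close> makes the latter nonzero (i = 0) and distinct (i > 0).\<close>
  define a where "a = (\<lambda>i\<in>{1..m}. of_int \<lfloor>y i\<rfloor> :: real)"
  define t where "t = (\<lambda>i\<in>{1..m}. y i - a i)"
  have t: "t i = frac (y i)" if "i \<in> {1..m}" for i
    using that by (simp add: t_def a_def frac_def)
  have "\<exists>w. w permutes {1..m} \<and> t \<in> nabla m w"
  proof (rule nabla_exists)
    show "t \<in> rpoints m" by (auto simp: t_def)
    show "0 < t i \<and> t i < 1" if "i \<in> {1..m}" for i
      using t[OF that] gen[of 0 i] that by (auto simp: anchor_def frac_lt_1)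
    show "inj_on t {1..m}"
    proof (rule linorder_inj_onI')
      fix i j assume ij: "i \<in> {1..m}" "j \<in> {1..m}" "i < j"
      then have "y j - y i \<notin> \<int>" using gen[of i j] by (auto simp: anchor_def)
      moreover have "y j - y i = of_int (\<lfloor>y j\<rfloor> - \<lfloor>y i\<rfloor>)" if "t i = t j"
        using that ij by (simp add: t frac_def)
      ultimately show "t i \<noteq> t j" by (metis Ints_of_int)
    qed
  qed
  moreover have "a \<in> lattice_points m" by (auto simp: a_def)
  ultimately show ?thesis using y unfolding cell_def t_def by blast
qed

text \<open>Counting replaces integration: almost every point lies in a lattice cell, each cell is
  wholly inside or wholly outside B, and all cells have equal volume.\<close>

lemma measure_union_of_cells:
  assumes B: "B \<in> sets (lborel_pow m)" and F: "finite F"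
    and sub: "\<And>a w. (a, w) \<in> F \<Longrightarrow> a \<in> lattice_points m \<and> w permutes {1..m}"
    and iff: "\<And>a w y. a \<in> lattice_points m \<Longrightarrow> w permutes {1..m} \<Longrightarrow> y \<in> cell m a w \<Longrightarrow> y \<in> B \<longleftrightarrow> (a, w) \<in> F"
  shows "measure (lborel_pow m) B = real (card F) * measure (lborel_pow m) (nabla m id)"
proof -
  let ?U = "\<Union>(a, w)\<in>F. cell m a w"
  have U: "(\<Union>p\<in>F. cell m (fst p) (snd p)) = ?U" by (auto simp: case_prod_unfold)
  have setsU: "cell m (fst p) (snd p) \<in> sets (lborel_pow m)" if "p \<in> F" for p
    using sub[of "fst p" "snd p"] that by (auto intro!: sets_cell simp del: One_nat_def)
  have "measure (lborel_pow m) B = measure (lborel_pow m) ?U"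
  proof (rule measure_eq_AE)
    show "?U \<in> sets (lborel_pow m)" unfolding U[symmetric] using F setsU by auto
    show "AE y in lborel_pow m. y \<in> B \<longleftrightarrow> y \<in> ?U"
      using AE_anchor_diff_notin_Ints AE_space
    proof eventually_elim
      case (elim y)
      then obtain a w where aw: "a \<in> lattice_points m" "w permutes {1..m}" "y \<in> cell m a w"
        using cell_exists[of y m] unfolding space_lborel_pow by blast
      show ?case
      proof
        assume "y \<in> B"
        then show "y \<in> ?U" using iff[OF aw] aw by blast
      next
        assume "y \<in> ?U"
        then obtain a' w' where *: "(a', w') \<in> F" "y \<in> cell m a' w'" by blast
        then show "y \<in> B" using iff sub by blast
      qed
    qed
  qed (rule B)
  also have "\<dots> = (\<Sum>p\<in>F. measure (lborel_pow m) (cell m (fst p) (snd p)))"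
    unfolding U[symmetric]
  proof (rule measure_finite_Union[OF F])
    show "disjoint_family_on (\<lambda>p. cell m (fst p) (snd p)) F"
      unfolding disjoint_family_on_def
    proof (intro ballI impI)
      fix p q assume pq: "p \<in> F" "q \<in> F" "p \<noteq> q"
      then show "cell m (fst p) (snd p) \<inter> cell m (fst q) (snd q) = {}"
        using cell_unique[of "snd p" m "snd q" "fst p" "fst q"] sub[of "fst p" "snd p"] sub[of "fst q" "snd q"]
        by (metis IntE equals0I prod.collapse)
    qed
    show "emeasure (lborel_pow m) (cell m (fst p) (snd p)) \<noteq> \<infinity>" if "p \<in> F" for p
      using that sub[of "fst p" "snd p"] emeasure_cell emeasure_nabla_id_finite by simp
  qed (use setsU in auto)
  also have "\<dots> = (\<Sum>p\<in>F. measure (lborel_pow m) (nabla m id))"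
    using sub by (intro sum.cong) (auto simp: measure_def emeasure_cell simp del: One_nat_def)
  finally show ?thesis by simp
qed

text \<open>The counting principle applied to the open unit cube, whose volume is 1 and whose cells
  are the m! ones with a = 0.\<close>

lemma measure_nabla_id: "measure (lborel_pow m) (nabla m id) = 1 / fact m"
proof -
  let ?z = "\<lambda>i\<in>{1..m}. 0 :: real"
  let ?F = "{?z} \<times> {w. w permutes {1..m}}"
  let ?C = "{1..m} \<rightarrow>\<^sub>E {0<..<1} :: (nat \<Rightarrow> real) set"
  have "measure (lborel_pow m) ?C = real (card ?F) * measure (lborel_pow m) (nabla m id)"
  proof (rule measure_union_of_cells)
    show "?C \<in> sets (lborel_pow m)" by (intro sets_PiM_I_finite) auto
    show "finite ?F" by (simp add: finite_permutations)
    fix a w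
    show "a \<in> lattice_points m \<and> w permutes {1..m}" if "(a, w) \<in> ?F"
      using that by auto
    fix y assume aw: "a \<in> lattice_points m" "w permutes {1..m}" "y \<in> cell m a w"
    have ya: "0 < y i - a i \<and> y i - a i < 1" if "i \<in> {1..m}" for i
      using aw(3) that unfolding cell_def nabla_iff[OF aw(2)] by auto
    have y: "y \<in> rpoints m" using aw(3) by (simp add: cell_def)
    show "y \<in> ?C \<longleftrightarrow> (a, w) \<in> ?F"
    proof
      assume C: "y \<in> ?C"
      have "a = ?z"
      proof (rule PiE_ext[OF aw(1)])
        show "?z \<in> lattice_points m" by auto
        fix i assume i: "i \<in> {1..m}"
        \<comment> \<open>Both y_i and y_i - a_i lie in (0, 1).\<close>
        have "\<bar>a i\<bar> < 1" using ya[OF i] PiE_mem[OF C i] by auto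
        moreover have "a i \<in> \<int>" using PiE_mem[OF aw(1) i] .
        ultimately show "a i = ?z i" using i Ints_nonzero_abs_less1 by auto
      qed
      then show "(a, w) \<in> ?F" using aw by simp
    next
      assume "(a, w) \<in> ?F"
      then show "y \<in> ?C" using ya y by (auto simp: PiE_iff)
    qed
  qed
  moreover have "card ?F = fact m"
    using card_permutations[of "{1..m}" m] by (simp add: card_cartesian_product)
  ultimately show ?thesis
    using emeasure_unit_cube[of m] by (simp add: measure_def field_simps)
qed

section \<open>Partial sums, descents and Stanley's map\<close>

lemma sum_segment_eq_diff:
  fixes x :: "nat \<Rightarrow> real"
  assumes "i \<le> j"
  shows "(\<Sum>k = i + 1..j. x k) = (\<Sum>k = 1..j. x k) - (\<Sum>k = 1..i. x k)"
proof -
  have "{1..j} = {1..i} \<union> {i + 1..j}" "{1..i} \<inter> {i + 1..j} = {}" using assms by auto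
  then have "(\<Sum>k = 1..j. x k) = (\<Sum>k = 1..i. x k) + (\<Sum>k = i + 1..j. x k)"
    by (metis finite_atLeastAtMost sum.union_disjoint)
  then show ?thesis by simp
qed

lemma anchor_psum: "i \<le> m \<Longrightarrow> anchor (psum m x) i = (\<Sum>k = 1..i. x k)"
  by (auto simp: anchor_def psum_def)

text \<open>The explicit differences are recorded because they make x integral whenever u
  is.\<close>

lemma exists_partial_sums:
  fixes u :: "nat \<Rightarrow> real"
  assumes "u 0 = 0"
  shows "\<exists>x\<in>rpoints m. (\<forall>i\<le>m. (\<Sum>k = 1..i. x k) = u i) \<and> (\<forall>k\<in>{1..m}. x k = u k - u (k - 1))"
proof -
  let ?x = "\<lambda>k\<in>{1..m}. u k - u (k - 1)"
  have "(\<Sum>k = 1..i. ?x k) = u i" if "i \<le> m" for i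
    using that by (induction i) (simp_all add: assms)
  then show ?thesis by (intro bexI[of _ ?x]) auto
qed

text \<open>Counting from \<open>k = 0\<close> is harmless: \<open>inv w 0 = 0\<close> for a permutation \<open>w\<close> of \<open>{1..m}\<close>, so \<open>0\<close> is never
  a descent.\<close>

definition descents_below :: "(nat \<Rightarrow> nat) \<Rightarrow> nat \<Rightarrow> nat" where
  "descents_below w i = card {k. k < i \<and> inv w (Suc k) < inv w k}"

lemma descents_below_0 [simp]: "descents_below w 0 = 0"
  by (simp add: descents_below_def)

lemma descents_below_Suc:
  "descents_below w (Suc i) = descents_below w i + of_bool (inv w (Suc i) < inv w i)"
proof -
  have "{k. k < Suc i \<and> inv w (Suc k) < inv w k} =
      {k. k < i \<and> inv w (Suc k) < inv w k} \<union> (if inv w (Suc i) < inv w i then {i} else {})"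
    by (auto simp: less_Suc_eq)
  then show ?thesis by (auto simp: descents_below_def)
qed

lemma of_bool_inv_less_swap:
  assumes "w permutes S" "i \<noteq> j"
  shows "(of_bool (inv w j < inv w i) :: real) = 1 - of_bool (inv w i < (inv w j :: nat))"
proof -
  have "inv w i \<noteq> inv w j" using assms permutes_inj[OF permutes_inv] by (metis injD)
  then show ?thesis by auto
qed

text \<open>Each step adds a number in [0, 1] to the partial sum, so the integer part goes up by 1
  exactly when the fractional part decreases, that is, at a descent of \<open>inv w\<close>.\<close>

lemma floor_partial_sum_eq_descents:
  assumes w: "w permutes {1..m}" and z: "z \<in> {1..m} \<rightarrow>\<^sub>E {0..1}"
    and t: "stanley_map m z \<in> nabla m w" and "i \<le> m"
  shows "\<lfloor>\<Sum>k = 1..i. z k\<rfloor> = int (descents_below w i)"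
  using \<open>i \<le> m\<close>
proof (induction i)
  case (Suc i)
  define s where "s i = (\<Sum>k = 1..i. z k)" for i
  have a: "anchor (stanley_map m z) i = s i - of_int \<lfloor>s i\<rfloor>" if "i \<le> m" for i
    using that by (auto simp: anchor_def stanley_map_def s_def)
  have "z (Suc i) \<in> {0..1}" using z Suc.prems by (intro PiE_mem[OF z]) simp
  moreover have "s (Suc i) = s i + z (Suc i)" by (simp add: s_def)
  moreover note nabla_anchor_diff_bounds[OF w t, of i "Suc i"] of_bool_inv_less_swap[OF w, of i "Suc i"]
    a[of i] a[of "Suc i"]
  \<comment> \<open>The integer increment is z_(i+1) minus the difference of fractional parts, which
    lies in (-1, 0) at a descent and in (0, 1) otherwise.\<close>
  ultimately have
    "\<bar>real_of_int (\<lfloor>s (Suc i)\<rfloor> - \<lfloor>s i\<rfloor> - of_bool (inv w (Suc i) < inv w i))\<bar> < 1"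
    using Suc.prems by auto
  then have "\<lfloor>s (Suc i)\<rfloor> - \<lfloor>s i\<rfloor> - of_bool (inv w (Suc i) < inv w i) = 0"
    by linarith
  then show ?case using Suc by (simp add: descents_below_Suc s_def)
qed simp

text \<open>The integer parts of the partial sums being forced, taking fractional parts amounts to
  subtracting one fixed lattice vector. So the preimage is a single cell in the partial-sum
  coordinates.\<close>

lemma stanley_preimage_iff:
  assumes w: "w permutes {1..m}"
  shows "z \<in> {1..m} \<rightarrow>\<^sub>E {0..1} \<and> stanley_map m z \<in> nabla m w \<longleftrightarrow>
    z \<in> rpoints m \<and> psum m z \<in> cell m (\<lambda>i. real (descents_below w i)) w"
proof
  assume z: "z \<in> {1..m} \<rightarrow>\<^sub>E {0..1} \<and> stanley_map m z \<in> nabla m w"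
  have "(\<lambda>i\<in>{1..m}. psum m z i - real (descents_below w i)) = stanley_map m z"
    unfolding stanley_map_def psum_def
    using floor_partial_sum_eq_descents[OF w conjunct1[OF z] conjunct2[OF z]]
    by (intro restrict_ext) simp
  moreover have "z \<in> rpoints m" using z by (auto simp: PiE_iff)
  ultimately show "z \<in> rpoints m \<and> psum m z \<in> cell m (\<lambda>i. real (descents_below w i)) w"
    using z by (simp add: cell_def psum_def)
next
  assume z: "z \<in> rpoints m \<and> psum m z \<in> cell m (\<lambda>i. real (descents_below w i)) w"
  define t where "t = (\<lambda>i\<in>{1..m}. psum m z i - real (descents_below w i))"
  have t: "t \<in> nabla m w" using z by (simp add: cell_def t_def)
  have s: "(\<Sum>k = 1..i. z k) = anchor t i + real (descents_below w i)" if "i \<le> m" for i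
    using that by (auto simp: t_def anchor_def psum_def)
  have "stanley_map m z = t"
  proof
    fix i
    show "stanley_map m z i = t i"
    proof (cases "i \<in> {1..m}")
      case True
      then have b: "0 \<le> anchor t i" "anchor t i < 1" using nabla_anchor_bounds[OF w t, of i] by auto
      have "anchor t i = t i" using True by (simp add: anchor_def)
      moreover have "\<lfloor>anchor t i + real (descents_below w i)\<rfloor> = int (descents_below w i)"
        using b by linarith
      ultimately show ?thesis using True s[of i] by (simp add: stanley_map_def)
    next
      case False
      then show ?thesis unfolding t_def stanley_map_def by (simp del: atLeastAtMost_iff)
    qed
  qed
  moreover have "z k \<in> {0..1}" if k: "k \<in> {1..m}" for k
  proof -
    obtain i where i: "k = Suc i" "Suc i \<le> m" using k by (cases k) auto
    have "(\<Sum>k = 1..Suc i. z k) = (\<Sum>k = 1..i. z k) + z (Suc i)" by simp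
    \<comment> \<open>At a descent the difference of t lies in (-1, 0) and is raised by 1; elsewhere
      it already lies in (0, 1).\<close>
    then have "z (Suc i) = anchor t (Suc i) - anchor t i + of_bool (inv w (Suc i) < inv w i)"
      using s[of i] s[of "Suc i"] i by (simp add: descents_below_Suc)
    then show ?thesis
      using nabla_anchor_diff_bounds[OF w t, of i "Suc i"] of_bool_inv_less_swap[OF w, of i "Suc i"] i
      by (auto simp del: of_bool_eq)
  qed
  ultimately show "z \<in> {1..m} \<rightarrow>\<^sub>E {0..1} \<and> stanley_map m z \<in> nabla m w"
    using z t by (auto simp: PiE_iff)
qed

text \<open>Surjectivity onto the simplex: it makes bounds over the preimage equivalent to bounds
  over \<open>nabla m w\<close>, and the preimage nonempty.\<close>

lemma stanley_preimage_of_nabla: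
  assumes w: "w permutes {1..m}" and t: "t \<in> nabla m w"
  shows "\<exists>z\<in>{z \<in> {1..m} \<rightarrow>\<^sub>E {0..1}. stanley_map m z \<in> nabla m w}.
    \<forall>i\<le>m. (\<Sum>k = 1..i. z k) = anchor t i + real (descents_below w i)"
proof -
  let ?D = "\<lambda>i. real (descents_below w i)"
  obtain z where z: "z \<in> rpoints m" "\<forall>i\<le>m. (\<Sum>k = 1..i. z k) = anchor t i + ?D i"
    using exists_partial_sums[of "\<lambda>i. anchor t i + ?D i" m] by (auto simp: anchor_def)
  have "(\<lambda>i\<in>{1..m}. psum m z i - ?D i) = t"
  proof (rule PiE_ext[of _ "{1..m}" "\<lambda>_. UNIV"])
    show "t \<in> rpoints m" using t nabla_subset_rpoints by blast
    fix k assume "k \<in> {1..m}"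
    then show "(\<lambda>i\<in>{1..m}. psum m z i - ?D i) k = t k"
      using z(2) by (simp add: psum_def anchor_def)
  qed auto
  then have "psum m z \<in> cell m ?D w" using t by (simp add: cell_def psum_def)
  then show ?thesis using z stanley_preimage_iff[OF w, of z] by blast
qed

section \<open>Extreme values of coordinate differences\<close>

text \<open>Moving a point of \<open>\<nabla>\<^sub>w\<close> towards a vertex \<open>v\<close> of its closure stays inside \<open>\<nabla>\<^sub>w\<close>; the suprema of the
  linear forms \<open>t\<^sub>j - t\<^sub>i\<close> over \<open>\<nabla>\<^sub>w\<close> are obtained as limits of this kind.\<close>

lemma nabla_towards_vertex:
  assumes w: "w permutes {1..m}" and s: "s \<in> nabla m w" and e: "0 < e" "e \<le> 1"
    and v: "\<And>i. v i = 0 \<or> v i = 1" "\<And>i j. inv w i < inv w j \<Longrightarrow> v i \<le> v j"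
  shows "(\<lambda>i\<in>{1..m}. (1 - e) * v i + e * s i) \<in> nabla m w" (is "?t \<in> _")
proof -
  have s': "0 < s i" "s i < 1" if "i \<in> {1..m}" for i using s that unfolding nabla_iff[OF w] by blast+
  have less: "s i < s j" if "i \<in> {1..m}" "j \<in> {1..m}" "inv w i < inv w j" for i j
    using s that unfolding nabla_iff[OF w] by blast
  have "0 < ?t i \<and> ?t i < 1" if i: "i \<in> {1..m}" for i
  proof -
    have "0 < e * s i" "e * s i < e" using s'[OF i] e by auto
    moreover have "?t i = (1 - e) * v i + e * s i" using i by simp
    moreover have "(1 - e) * v i = 0 \<or> (1 - e) * v i = 1 - e" using v(1)[of i] by auto
    ultimately show ?thesis using e by linarith
  qed
  moreover have "?t i < ?t j" if ij: "i \<in> {1..m}" "j \<in> {1..m}" "inv w i < inv w j" for i j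
  proof -
    have "e * s i < e * s j" using less[OF ij] e by simp
    moreover have "(1 - e) * v i \<le> (1 - e) * v j" using v(2)[OF ij(3)] e by (intro mult_left_mono) auto
    ultimately show ?thesis using ij by simp
  qed
  moreover have "?t \<in> rpoints m" by simp
  ultimately show ?thesis unfolding nabla_iff[OF w] by blast
qed

lemma nabla_diff_le_iff:
  assumes w: "w permutes {1..m}" and ij: "i \<le> m" "j \<le> m" "i \<noteq> j"
  shows "(\<forall>t\<in>nabla m w. anchor t j - anchor t i \<le> c) \<longleftrightarrow> of_bool (inv w i < inv w j) \<le> c"
proof
  assume c: "\<forall>t\<in>nabla m w. anchor t j - anchor t i \<le> c"
  \<comment> \<open>If i precedes j in position, this is the vertex with ones from the position of j
    onwards; otherwise it is the zero vertex. Either way v_j - v_i is the supremum sought, and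
    \<open>v 0 = 0\<close>.\<close>
  define v :: "nat \<Rightarrow> real" where "v k = of_bool (inv w i < inv w j \<and> inv w j \<le> inv w k)" for k
  obtain s where s: "s \<in> nabla m w" using nabla_nonempty[OF w] by blast
  show "of_bool (inv w i < inv w j) \<le> c"
  proof (rule field_le_epsilon)
    fix e :: real assume "0 < e"
    define d where "d = min e 1"
    have d: "0 < d" "d \<le> 1" "d \<le> e" using \<open>0 < e\<close> by (auto simp: d_def)
    let ?t = "\<lambda>k\<in>{1..m}. (1 - d) * v k + d * s k"
    have "?t \<in> nabla m w"
      by (rule nabla_towards_vertex[OF w s d(1,2)]) (auto simp: v_def)
    then have "anchor ?t j - anchor ?t i \<le> c" using c by blast
    moreover have a: "anchor ?t k = (1 - d) * v k + d * anchor s k" if "k \<le> m" for k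
      using that inv_permutes_0[OF w] by (auto simp: anchor_def v_def)
    have "anchor ?t j - anchor ?t i = (1 - d) * (v j - v i) + d * (anchor s j - anchor s i)"
      unfolding a[OF ij(1)] a[OF ij(2)] by (simp add: algebra_simps)
    moreover have "v j - v i = of_bool (inv w i < inv w j)" by (auto simp: v_def)
    ultimately have "(1 - d) * of_bool (inv w i < inv w j) + d * (anchor s j - anchor s i) \<le> c"
      by simp
    \<comment> \<open>The difference for s exceeds the supremum minus 1, so the convex combination
      falls short of the supremum by at most d.\<close>
    moreover have "d * (of_bool (inv w i < inv w j) - 1) \<le> d * (anchor s j - anchor s i)"
      using nabla_anchor_diff_bounds(1)[OF w s ij] d by (intro mult_left_mono) auto
    ultimately show "of_bool (inv w i < inv w j) \<le> c + e"
      using d by (simp add: algebra_simps)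
  qed
next
  assume "of_bool (inv w i < inv w j) \<le> c"
  then show "\<forall>t\<in>nabla m w. anchor t j - anchor t i \<le> c"
    using nabla_anchor_diff_bounds(2)[OF w _ ij] by fastforce
qed

text \<open>The infimum of t_j - t_i is minus the supremum of t_i - t_j.\<close>

lemma nabla_diff_bounds_iff:
  assumes w: "w permutes {1..m}" and ij: "i \<le> m" "j \<le> m" "i \<noteq> j"
  shows "(\<forall>t\<in>nabla m w. b \<le> anchor t j - anchor t i \<and> anchor t j - anchor t i \<le> c) \<longleftrightarrow>
    b \<le> of_bool (inv w i < inv w j) - 1 \<and> of_bool (inv w i < inv w j) \<le> c"
proof -
  have "(\<forall>t\<in>nabla m w. b \<le> anchor t j - anchor t i) \<longleftrightarrow> (\<forall>t\<in>nabla m w. anchor t i - anchor t j \<le> - b)"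
    by (intro ball_cong) auto
  also have "\<dots> \<longleftrightarrow> of_bool (inv w j < inv w i) \<le> - b"
    using ij by (intro nabla_diff_le_iff[OF w]) auto
  also have "\<dots> \<longleftrightarrow> b \<le> of_bool (inv w i < inv w j) - 1"
    unfolding of_bool_inv_less_swap[OF w ij(3)] by linarith
  finally show ?thesis unfolding nabla_diff_le_iff[OF w ij, symmetric] by blast
qed

text \<open>The condition that the cell \<open>a + \<nabla>\<^sub>w\<close> satisfies all the inequalities: on it, \<open>y\<^sub>j - y\<^sub>i\<close> takes
  exactly the values in an open interval of length 1 whose upper end is \<open>a\<^sub>j - a\<^sub>i\<close>, plus 1 if
  \<open>w\<^sup>-\<^sup>1(i) < w\<^sup>-\<^sup>1(j)\<close>.\<close>

definition fits ::
    "nat \<Rightarrow> (nat \<Rightarrow> nat \<Rightarrow> int) \<Rightarrow> (nat \<Rightarrow> nat \<Rightarrow> int) \<Rightarrow> (nat \<Rightarrow> nat) \<Rightarrow> (nat \<Rightarrow> real) \<Rightarrow> bool" where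
  "fits m b c w a \<longleftrightarrow> (\<forall>i j. i < j \<and> j \<le> m \<longrightarrow>
     of_int (b i j) \<le> anchor a j - anchor a i + (of_bool (inv w i < inv w j) - 1) \<and>
     anchor a j - anchor a i + of_bool (inv w i < inv w j) \<le> of_int (c i j))"

lemma fits_cong:
  assumes "\<And>i. i \<in> {1..m} \<Longrightarrow> a i = a' i"
  shows "fits m b c w a \<longleftrightarrow> fits m b c w a'"
proof -
  have "anchor a i = anchor a' i" if "i \<le> m" for i
    using assms that by (simp add: anchor_def)
  then show ?thesis unfolding fits_def by (auto simp: less_imp_le_nat) 
qed

lemma fits_partial_sums_iff:
  fixes x :: "nat \<Rightarrow> real"
  shows "fits m b c w (\<lambda>i. (\<Sum>k = 1..i. x k) + real (descents_below w i)) \<longleftrightarrow>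
    (\<forall>i j. i < j \<and> j \<le> m \<longrightarrow>
      of_int (b i j) \<le> ((\<Sum>k = i + 1..j. x k) + (real (descents_below w j) - real (descents_below w i)))
        + (of_bool (inv w i < inv w j) - 1) \<and>
      ((\<Sum>k = i + 1..j. x k) + (real (descents_below w j) - real (descents_below w i)))
        + of_bool (inv w i < inv w j) \<le> of_int (c i j))"
proof -
  let ?a = "\<lambda>i. (\<Sum>k = 1..i. x k) + real (descents_below w i)"
  have "anchor ?a i = ?a i" for i by (simp add: anchor_def)
  then have "anchor ?a j - anchor ?a i
      = (\<Sum>k = i + 1..j. x k) + (real (descents_below w j) - real (descents_below w i))" if "i < j" for i j
    unfolding sum_segment_eq_diff[OF less_imp_le_nat[OF that]] by simp
  then show ?thesis unfolding fits_def by auto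
qed

section \<open>The polytope of admissible translations\<close>

abbreviation alcoved_set ::
    "nat \<Rightarrow> int \<Rightarrow> (nat \<Rightarrow> nat \<Rightarrow> int) \<Rightarrow> (nat \<Rightarrow> nat \<Rightarrow> int) \<Rightarrow> (nat \<Rightarrow> real) set" where
  "alcoved_set n l b c \<equiv> {x \<in> rpoints n.
     (\<Sum>k = 1..n. x k) = of_int l \<and>
     (\<forall>i j. i < j \<and> j \<le> n - 1 \<longrightarrow>
        of_int (b i j) \<le> (\<Sum>k = i + 1..j. x k) \<and> (\<Sum>k = i + 1..j. x k) \<le> of_int (c i j))}"

text \<open>Weak bounds on a continuous function are closed conditions. This allows the closed
  Stanley simplex to be tested on the preimage of \<open>nabla m w\<close>.\<close>

lemma closure_of_bounds_iff:
  assumes f: "continuous_map X euclideanreal f" and "Z \<subseteq> topspace X"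
  shows "(\<forall>z\<in>X closure_of Z. b \<le> f z \<and> f z \<le> c) \<longleftrightarrow> (\<forall>z\<in>Z. b \<le> f z \<and> f z \<le> c)"
proof -
  have "closedin X {z \<in> topspace X. f z \<in> {b..c}}"
    by (rule closedin_continuous_map_preimage[OF f]) simp
  then have "X closure_of Z \<subseteq> {z \<in> topspace X. f z \<in> {b..c}} \<longleftrightarrow> Z \<subseteq> {z \<in> topspace X. f z \<in> {b..c}}"
    by (rule closure_of_minimal_eq[OF assms(2)])
  then show ?thesis using assms(2) closure_of_subset_topspace[of X Z] by fastforce
qed

text \<open>A segment sum of z is t_j - t_i plus a constant difference of descent counts, with t
  ranging over all of \<open>nabla m w\<close>.\<close>

lemma stanley_preimage_segment_iff:
  assumes w: "w permutes {1..m}" and ij: "i < j" "j \<le> m"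
  shows "(\<forall>z\<in>{z \<in> {1..m} \<rightarrow>\<^sub>E {0..1}. stanley_map m z \<in> nabla m w}.
        b \<le> (\<Sum>k = i + 1..j. z k) \<and> (\<Sum>k = i + 1..j. z k) \<le> c) \<longleftrightarrow>
      b \<le> real (descents_below w j) - real (descents_below w i) + (of_bool (inv w i < inv w j) - 1) \<and>
      real (descents_below w j) - real (descents_below w i) + of_bool (inv w i < inv w j) \<le> c"
    (is "(\<forall>z\<in>?Z. ?P z) \<longleftrightarrow> _")
proof -
  let ?D = "\<lambda>i. real (descents_below w i)"
  let ?R = "\<lambda>t. b - (?D j - ?D i) \<le> anchor t j - anchor t i \<and> anchor t j - anchor t i \<le> c - (?D j - ?D i)"
  have "(\<forall>z\<in>?Z. ?P z) \<longleftrightarrow> (\<forall>t\<in>nabla m w. ?R t)"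
  proof
    assume P: "\<forall>z\<in>?Z. ?P z"
    show "\<forall>t\<in>nabla m w. ?R t"
    proof
      fix t assume t: "t \<in> nabla m w"
      then obtain z where z: "z \<in> ?Z" "\<forall>i\<le>m. (\<Sum>k = 1..i. z k) = anchor t i + ?D i"
        using stanley_preimage_of_nabla[OF w] by blast
      then have "?P z" using P by blast
      then show "?R t" using z(2) ij unfolding sum_segment_eq_diff[OF less_imp_le_nat[OF ij(1)]] by auto
    qed
  next
    assume R: "\<forall>t\<in>nabla m w. ?R t"
    show "\<forall>z\<in>?Z. ?P z"
    proof
      fix z assume "z \<in> ?Z"
      then have "psum m z \<in> cell m ?D w" using stanley_preimage_iff[OF w, of z] by simp
      then have t: "(\<lambda>i\<in>{1..m}. psum m z i - ?D i) \<in> nabla m w" (is "?t \<in> _") by (simp add: cell_def)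
      have "anchor ?t k = (\<Sum>k = 1..k. z k) - ?D k" if "k \<le> m" for k
        using that by (auto simp: anchor_def psum_def)
      then show "?P z" using R[rule_format, OF t] ij
        unfolding sum_segment_eq_diff[OF less_imp_le_nat[OF ij(1)]] by auto
    qed
  qed
  also have "\<dots> \<longleftrightarrow> b - (?D j - ?D i) \<le> of_bool (inv w i < inv w j) - 1 \<and>
      of_bool (inv w i < inv w j) \<le> c - (?D j - ?D i)"
    using ij by (intro nabla_diff_bounds_iff[OF w]) auto
  also have "\<dots> \<longleftrightarrow> b \<le> ?D j - ?D i + (of_bool (inv w i < inv w j) - 1) \<and>
      ?D j - ?D i + of_bool (inv w i < inv w j) \<le> c"
    by linarith
  finally show ?thesis .
qed

text \<open>Segment sums are additive under translation, so containment of the translate reduces to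
  the extreme segment sums over the simplex.\<close>

lemma translation_polytope_iff:
  assumes n: "n \<ge> 1" and w: "w permutes {1..n - 1}"
  shows "x \<in> translation_polytope n (alcoved_set n l b c) w \<longleftrightarrow>
    x \<in> rpoints n \<and> (\<Sum>k = 1..n. x k) = of_int (l - int (simplex_level (n - 1) w)) \<and>
    fits (n - 1) b c w (\<lambda>i. (\<Sum>k = 1..i. x k) + real (descents_below w i))"
    (is "_ \<longleftrightarrow> _ \<and> ?total \<and> ?fits")
proof -
  define m where "m = n - 1"
  have n': "n = Suc m" using n by (simp add: m_def)
  let ?X = "product_topology (\<lambda>_. euclideanreal) {1..m}"
  let ?Z = "{z \<in> {1..m} \<rightarrow>\<^sub>E {0..1}. stanley_map m z \<in> nabla m w}"
  let ?S = "stanley_simplex n w"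
  let ?lev = "real (simplex_level m w)"
  let ?D = "\<lambda>i. real (descents_below w i)"
  let ?seg = "\<lambda>(x :: nat \<Rightarrow> real) i j. \<Sum>k = i + 1..j. x k"
  have wm: "w permutes {1..m}" using w by (simp add: m_def)
  have top: "?Z \<subseteq> topspace ?X" unfolding topspace_product_topology subset_iff by (simp add: PiE_iff)
  have Z_ne: "?Z \<noteq> {}"
  proof -
    obtain t where t: "t \<in> nabla m w" using nabla_nonempty[OF wm] by blast
    then show ?thesis using stanley_preimage_of_nabla[OF wm] by blast
  qed
  have S_iff: "d \<in> ?S \<longleftrightarrow> d \<in> rpoints n \<and> (\<Sum>k = 1..n. d k) = ?lev \<and> restrict d {1..m} \<in> ?X closure_of ?Z" for d
    unfolding stanley_simplex_def m_def by simp
  \<comment> \<open>The last coordinate is recovered from the prescribed total, so the simplex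
    projects onto the whole closure.\<close>
  have lift: "\<exists>d\<in>?S. restrict d {1..m} = z" if z: "z \<in> ?X closure_of ?Z" for z
  proof -
    let ?d = "(\<lambda>k\<in>{1..n}. if k = n then ?lev - (\<Sum>k = 1..m. z k) else z k)"
    have "z \<in> rpoints m" using z closure_of_subset_topspace[of ?X ?Z] by auto
    then have r: "restrict ?d {1..m} = z"
      unfolding n' by (intro ext) (auto simp: PiE_iff extensional_def restrict_def)
    have "(\<Sum>k = 1..m. ?d k) = (\<Sum>k = 1..m. z k)"
      unfolding n' by (intro sum.cong) auto
    then have "(\<Sum>k = 1..n. ?d k) = ?lev" unfolding n' by simp
    then have "?d \<in> ?S" unfolding S_iff r using z by simp
    then show ?thesis using r by blast
  qed
  \<comment> \<open>Over an empty simplex, containment would be vacuous and would not fix the sum of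
    x.\<close>
  have S_ne: "?S \<noteq> {}"
    using lift closure_of_subset[OF top] Z_ne by blast
  have seg_restrict: "?seg d i j = ?seg (restrict d {1..m}) i j" if "j \<le> m" for d i j
    using that by (intro sum.cong) auto
  have mem: "(\<lambda>i\<in>{1..n}. d i + x i) \<in> alcoved_set n l b c \<longleftrightarrow>
      (\<Sum>k = 1..n. x k) = of_int l - ?lev \<and>
      (\<forall>i j. i < j \<and> j \<le> m \<longrightarrow> of_int (b i j) - ?seg x i j \<le> ?seg (restrict d {1..m}) i j \<and>
        ?seg (restrict d {1..m}) i j \<le> of_int (c i j) - ?seg x i j)" if d: "d \<in> ?S" for d
  proof -
    let ?y = "\<lambda>i\<in>{1..n}. d i + x i"
    have tot: "(\<Sum>k = 1..n. ?y k) = (\<Sum>k = 1..n. d k) + (\<Sum>k = 1..n. x k)"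
      unfolding sum.distrib[symmetric] by (intro sum.cong) auto
    have seg: "?seg ?y i j = ?seg (restrict d {1..m}) i j + ?seg x i j" if "j \<le> m" for i j
      unfolding seg_restrict[OF that, symmetric] sum.distrib[symmetric]
      using that n' by (intro sum.cong) auto
    have "?y \<in> rpoints n" by simp
    moreover have "(\<Sum>k = 1..n. ?y k) = of_int l \<longleftrightarrow> (\<Sum>k = 1..n. x k) = of_int l - ?lev"
      unfolding tot using d unfolding S_iff by auto
    moreover have "(of_int (b i j) \<le> ?seg ?y i j \<and> ?seg ?y i j \<le> of_int (c i j)) \<longleftrightarrow>
        (of_int (b i j) - ?seg x i j \<le> ?seg (restrict d {1..m}) i j \<and>
        ?seg (restrict d {1..m}) i j \<le> of_int (c i j) - ?seg x i j)" if "j \<le> m" for i j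
      unfolding seg[OF that] by linarith
    ultimately show ?thesis unfolding mem_Collect_eq m_def[symmetric]
      by (simp only: simp_thms cong: imp_cong conj_cong)
  qed
  have cont: "continuous_map ?X euclideanreal (\<lambda>z. ?seg z i j)" if "j \<le> m" for i j
    using that by (intro continuous_map_sum continuous_map_product_projection) auto
  have seg_iff: "(\<forall>z\<in>?X closure_of ?Z. of_int (b i j) - ?seg x i j \<le> ?seg z i j \<and> ?seg z i j \<le> of_int (c i j) - ?seg x i j)
      \<longleftrightarrow> of_int (b i j) \<le> (?seg x i j + (?D j - ?D i)) + (of_bool (inv w i < inv w j) - 1) \<and>
        (?seg x i j + (?D j - ?D i)) + of_bool (inv w i < inv w j) \<le> of_int (c i j)"
    if ij: "i < j" "j \<le> m" for i j
    unfolding closure_of_bounds_iff[OF cont[OF ij(2)] top] stanley_preimage_segment_iff[OF wm ij]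
    by linarith
  have "x \<in> translation_polytope n (alcoved_set n l b c) w \<longleftrightarrow>
      x \<in> rpoints n \<and> (\<forall>d\<in>?S. (\<lambda>i\<in>{1..n}. d i + x i) \<in> alcoved_set n l b c)"
    unfolding translation_polytope_def translate_def image_subset_iff by simp
  also have "\<dots> \<longleftrightarrow> x \<in> rpoints n \<and> (\<Sum>k = 1..n. x k) = of_int l - ?lev \<and>
      (\<forall>d\<in>?S. \<forall>i j. i < j \<and> j \<le> m \<longrightarrow> of_int (b i j) - ?seg x i j \<le> ?seg (restrict d {1..m}) i j \<and>
        ?seg (restrict d {1..m}) i j \<le> of_int (c i j) - ?seg x i j)"
  proof -
    have *: "(\<forall>d\<in>D. T \<and> R d) \<longleftrightarrow> T \<and> (\<forall>d\<in>D. R d)" if "D \<noteq> {}" for D T and R :: "(nat \<Rightarrow> real) \<Rightarrow> bool"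
      using that by blast
    show ?thesis
      unfolding *[OF S_ne, symmetric] by (intro conj_cong refl ball_cong mem)
  qed
  also have "\<dots> \<longleftrightarrow> x \<in> rpoints n \<and> (\<Sum>k = 1..n. x k) = of_int l - ?lev \<and>
      (\<forall>i j. i < j \<and> j \<le> m \<longrightarrow> (\<forall>z\<in>?X closure_of ?Z. of_int (b i j) - ?seg x i j \<le> ?seg z i j \<and>
        ?seg z i j \<le> of_int (c i j) - ?seg x i j))"
  proof -
    let ?Q = "\<lambda>z i j. of_int (b i j) - ?seg x i j \<le> ?seg z i j \<and> ?seg z i j \<le> of_int (c i j) - ?seg x i j"
    have "(\<forall>d\<in>?S. \<forall>i j. i < j \<and> j \<le> m \<longrightarrow> ?Q (restrict d {1..m}) i j) \<longleftrightarrow>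
        (\<forall>i j. i < j \<and> j \<le> m \<longrightarrow> (\<forall>z\<in>?X closure_of ?Z. ?Q z i j))"
    proof
      assume L: "\<forall>d\<in>?S. \<forall>i j. i < j \<and> j \<le> m \<longrightarrow> ?Q (restrict d {1..m}) i j"
      show "\<forall>i j. i < j \<and> j \<le> m \<longrightarrow> (\<forall>z\<in>?X closure_of ?Z. ?Q z i j)"
      proof (intro allI impI ballI)
        fix i j z assume "i < j \<and> j \<le> m" and z: "z \<in> ?X closure_of ?Z"
        moreover obtain d where "d \<in> ?S" "restrict d {1..m} = z" using lift[OF z] by blast
        ultimately have "?Q (restrict d {1..m}) i j" using L by blast
        then show "?Q z i j" unfolding \<open>restrict d {1..m} = z\<close> .
      qed
    next
      assume R: "\<forall>i j. i < j \<and> j \<le> m \<longrightarrow> (\<forall>z\<in>?X closure_of ?Z. ?Q z i j)"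
      show "\<forall>d\<in>?S. \<forall>i j. i < j \<and> j \<le> m \<longrightarrow> ?Q (restrict d {1..m}) i j"
      proof (intro ballI allI impI)
        fix d i j assume "d \<in> ?S" and ij: "i < j \<and> j \<le> m"
        then have "restrict d {1..m} \<in> ?X closure_of ?Z" unfolding S_iff by blast
        then show "?Q (restrict d {1..m}) i j" using R ij by blast
      qed
    qed
    then show ?thesis by (intro conj_cong refl)
  qed
  also have "\<dots> \<longleftrightarrow> x \<in> rpoints n \<and> (\<Sum>k = 1..n. x k) = of_int l - ?lev \<and> ?fits"
    unfolding m_def[symmetric] fits_partial_sums_iff
    by (intro conj_cong refl iff_allI imp_cong seg_iff) auto
  finally show ?thesis unfolding m_def[symmetric] by simp
qed

lemma alcoved_polytope_translation_polytope:
  assumes n: "n \<ge> 1" and w: "w permutes {1..n - 1}"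
  shows "alcoved_polytope n (translation_polytope n (alcoved_set n l b c) w)"
proof -
  \<comment> \<open>The largest segment sum over the simplex, an integer, so it can be absorbed into
    b and c. The smallest is one less, whence the + 1 in the lower bounds.\<close>
  let ?d = "\<lambda>i j. int (descents_below w j) - int (descents_below w i) + of_bool (inv w i < inv w j)"
  have fits_eq: "fits (n - 1) b c w (\<lambda>i. (\<Sum>k = 1..i. x k) + real (descents_below w i)) \<longleftrightarrow>
      (\<forall>i j. i < j \<and> j \<le> n - 1 \<longrightarrow> of_int (b i j - ?d i j + 1) \<le> (\<Sum>k = i + 1..j. x k) \<and>
        (\<Sum>k = i + 1..j. x k) \<le> of_int (c i j - ?d i j))" for x
  proof -
    have *: "(of_int \<beta> \<le> (\<sigma> + (real p - real q)) + (of_bool e - 1) \<and> (\<sigma> + (real p - real q)) + of_bool e \<le> of_int \<gamma>) \<longleftrightarrow>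
        (of_int (\<beta> - (int p - int q + of_bool e) + 1) \<le> \<sigma> \<and> \<sigma> \<le> of_int (\<gamma> - (int p - int q + of_bool e)))"
      for \<beta> \<gamma> p q e and \<sigma> :: real
      by (cases e) auto
    show ?thesis unfolding fits_partial_sums_iff by (intro iff_allI imp_cong refl *)
  qed
  have "translation_polytope n (alcoved_set n l b c) w =
      alcoved_set n (l - int (simplex_level (n - 1) w)) (\<lambda>i j. b i j - ?d i j + 1) (\<lambda>i j. c i j - ?d i j)"
    by (rule set_eqI) (simp only: translation_polytope_iff[OF assms] mem_Collect_eq fits_eq)
  then show ?thesis unfolding alcoved_polytope_def by (intro exI)
qed

section \<open>Lattice points as cells\<close>

text \<open>Adding the descent counts to the partial sums of x gives the lattice point of the cell
  that the translated simplex occupies. This is bijective because the total determines the last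
  coordinate.\<close>

lemma lattice_count_translation_polytope:
  assumes n: "n \<ge> 1" and w: "w permutes {1..n - 1}"
  shows "lattice_count n (translation_polytope n (alcoved_set n l b c) w)
    = card {a \<in> lattice_points (n - 1). fits (n - 1) b c w a}"
proof -
  define m where "m = n - 1"
  have n': "n = Suc m" using n by (simp add: m_def)
  let ?D = "\<lambda>i. real (descents_below w i)"
  let ?T = "translation_polytope n (alcoved_set n l b c) w"
  let ?L = "of_int (l - int (simplex_level m w)) :: real"
  let ?f = "\<lambda>x. \<lambda>i\<in>{1..m}. (\<Sum>k = 1..i. x k) + ?D i"
  have T_iff: "x \<in> ?T \<longleftrightarrow> x \<in> rpoints n \<and> (\<Sum>k = 1..n. x k) = ?L \<and>
      fits m b c w (\<lambda>i. (\<Sum>k = 1..i. x k) + ?D i)" for x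
    unfolding m_def by (rule translation_polytope_iff[OF assms])
  have "bij_betw ?f (?T \<inter> lattice_points n) {a \<in> lattice_points m. fits m b c w a}"
  proof (rule bij_betw_imageI)
    show "inj_on ?f (?T \<inter> lattice_points n)"
    proof (rule inj_onI)
      fix x y assume x: "x \<in> ?T \<inter> lattice_points n" and y: "y \<in> ?T \<inter> lattice_points n" and eq: "?f x = ?f y"
      have part: "(\<Sum>k = 1..i. x k) = (\<Sum>k = 1..i. y k)" if "i \<le> n" for i
      proof -
        \<comment> \<open>The map records partial sums only up to m; the one at n is the common
          total \<open>?L\<close>.\<close>
        have "i = 0 \<or> i \<in> {1..m} \<or> i = n" using that n' by auto
        then consider "i = 0" | "i \<in> {1..m}" | "i = n" by blast
        then show ?thesis
        proof cases
          case 2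
          then show ?thesis using fun_cong[OF eq, of i] by simp
        next
          case 3
          have "(\<Sum>k = 1..n. x k) = ?L"
            using T_iff[THEN iffD1, OF IntD1[OF x]] by (elim conjE)
          moreover have "(\<Sum>k = 1..n. y k) = ?L"
            using T_iff[THEN iffD1, OF IntD1[OF y]] by (elim conjE)
          ultimately show ?thesis using 3 by simp
        qed simp
      qed
      show "x = y"
      proof (rule PiE_ext[of _ "{1..n}" "\<lambda>_. \<int>"])
        fix k assume "k \<in> {1..n}"
        then obtain i where "k = Suc i" "Suc i \<le> n" by (cases k) auto
        then show "x k = y k" using part[of i] part[of "Suc i"] by simp
      qed (use x y in blast)+
    qed
    show "?f ` (?T \<inter> lattice_points n) = {a \<in> lattice_points m. fits m b c w a}"
    proof (intro set_eqI iffI)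
      fix a assume "a \<in> ?f ` (?T \<inter> lattice_points n)"
      then obtain x where x: "x \<in> ?T" "x \<in> lattice_points n" "a = ?f x" by blast
      have "x k \<in> \<int>" if "k \<in> {1..m}" for k using PiE_mem[OF x(2), of k] that n' by simp
      then have "(\<Sum>k = 1..i. x k) + ?D i \<in> \<int>" if "i \<in> {1..m}" for i
        using that by (intro Ints_add Ints_sum) auto
      then have "a \<in> lattice_points m" unfolding x(3) by (simp add: restrict_PiE_iff)
      moreover have "fits m b c w a"
      proof (rule fits_cong[THEN iffD2])
        show "a i = (\<Sum>k = 1..i. x k) + ?D i" if "i \<in> {1..m}" for i
          using that unfolding x(3) by simp
        show "fits m b c w (\<lambda>i. (\<Sum>k = 1..i. x k) + ?D i)"
          using T_iff[THEN iffD1, OF x(1)] by (elim conjE)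
      qed
      ultimately show "a \<in> {a \<in> lattice_points m. fits m b c w a}" by blast
    next
      fix a assume "a \<in> {a \<in> lattice_points m. fits m b c w a}"
      then have a: "a \<in> lattice_points m" "fits m b c w a" by auto
      \<comment> \<open>The partial sums that a preimage of a must have: descents are subtracted up
        to m, and the total is prescribed at n.\<close>
      define u where "u i = (if i = n then ?L else anchor a i - ?D i)" for i
      have "u 0 = 0" by (simp add: u_def n' anchor_def)
      then obtain x where x: "x \<in> rpoints n" "\<forall>i\<le>n. (\<Sum>k = 1..i. x k) = u i"
          "\<forall>k\<in>{1..n}. x k = u k - u (k - 1)"
        using exists_partial_sums[of u n] by blast
      have "u i \<in> \<int>" if "i \<le> n" for i
      proof (cases "i = n")
        case False
        then have "i \<noteq> 0 \<Longrightarrow> a i \<in> \<int>" using PiE_mem[OF a(1), of i] that n' by simp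
        then show ?thesis using False by (auto simp: u_def anchor_def)
      qed (simp add: u_def)
      then have "x k \<in> \<int>" if "k \<in> {1..n}" for k using x(3) that by auto
      then have xl: "x \<in> lattice_points n" using x(1) by (simp add: PiE_iff)
      have ax: "(\<Sum>k = 1..i. x k) + ?D i = a i" if "i \<in> {1..m}" for i
        using x(2) that n' by (auto simp: u_def anchor_def)
      have "fits m b c w (\<lambda>i. (\<Sum>k = 1..i. x k) + ?D i)"
        by (rule fits_cong[THEN iffD2, OF ax a(2)])
      moreover have "(\<Sum>k = 1..n. x k) = ?L" using x(2) by (simp add: u_def)
      ultimately have "x \<in> ?T" using x(1) by (intro T_iff[THEN iffD2] conjI)
      moreover have "a = ?f x"
      proof (rule PiE_ext[of _ "{1..m}" "\<lambda>_. UNIV"])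
        show "a \<in> rpoints m" using a(1) by (auto simp: PiE_iff)
        show "a i = ?f x i" if "i \<in> {1..m}" for i using ax[OF that] that by simp
      qed simp
      ultimately show "a \<in> ?f ` (?T \<inter> lattice_points n)" using xl by blast
    qed
  qed
  then show ?thesis unfolding lattice_count_def m_def by (rule bij_betw_same_card)
qed

section \<open>Volume by counting cells\<close>

text \<open>The constraints with i = 0 confine each integer a_i to a bounded range.\<close>

lemma finite_fits: "finite {a \<in> lattice_points m. fits m b c w a}"
proof (rule finite_subset)
  let ?B = "\<lambda>i. {k \<in> \<int>. of_int (b 0 i) - 1 \<le> k \<and> k \<le> of_int (c 0 i) + 1} :: real set"
  show "finite (Pi\<^sub>E {1..m} ?B)" by (intro finite_PiE finite_int_segment) simp
  show "{a \<in> lattice_points m. fits m b c w a} \<subseteq> Pi\<^sub>E {1..m} ?B"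
  proof
    fix a assume a: "a \<in> {a \<in> lattice_points m. fits m b c w a}"
    have "a i \<in> ?B i" if i: "i \<in> {1..m}" for i
    proof -
      have "of_int (b 0 i) \<le> anchor a i - anchor a 0 + (of_bool (inv w 0 < inv w i) - 1) \<and>
          anchor a i - anchor a 0 + of_bool (inv w 0 < inv w i) \<le> of_int (c 0 i)"
        using a i unfolding fits_def by simp
      moreover have "anchor a i = a i" "anchor a 0 = 0" using i by (auto simp: anchor_def)
      moreover have "a i \<in> \<int>" using a i by auto
      ultimately show ?thesis by (auto simp: of_bool_def split: if_splits)
    qed
    then show "a \<in> Pi\<^sub>E {1..m} ?B" using a by (auto simp: PiE_iff)
  qed
qed

text \<open>On a cell, y_j - y_i stays strictly between two consecutive integers, so an integer
  bound holds at one point of the cell exactly when it holds at all of them.\<close>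

lemma cell_mem_bounds_iff:
  assumes a: "a \<in> lattice_points m" and w: "w permutes {1..m}" and y: "y \<in> cell m a w"
  shows "(\<forall>i j. i < j \<and> j \<le> m \<longrightarrow> of_int (b i j) \<le> anchor y j - anchor y i \<and>
      anchor y j - anchor y i \<le> of_int (c i j)) \<longleftrightarrow> fits m b c w a"
proof -
  let ?t = "\<lambda>i\<in>{1..m}. y i - a i"
  have t: "?t \<in> nabla m w" using y by (simp add: cell_def)
  have anchor_y: "anchor y i = anchor ?t i + anchor a i" if "i \<le> m" for i
    using that by (simp add: anchor_def)
  have anchor_a: "anchor a i \<in> \<int>" if "i \<le> m" for i
    using PiE_mem[OF a, of i] that by (simp add: anchor_def)
  have "(of_int (b i j) \<le> anchor y j - anchor y i \<and> anchor y j - anchor y i \<le> of_int (c i j)) \<longleftrightarrow>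
      (of_int (b i j) \<le> anchor a j - anchor a i + (of_bool (inv w i < inv w j) - 1) \<and>
       anchor a j - anchor a i + of_bool (inv w i < inv w j) \<le> of_int (c i j))" if ij: "i < j" "j \<le> m" for i j
  proof -
    have ij': "i \<le> m" "i \<noteq> j" using ij by auto
    have "anchor a j - anchor a i \<in> \<int>" using anchor_a ij by auto
    then obtain k :: int where k: "anchor a j - anchor a i = of_int k" by (auto elim: Ints_cases)
    define e :: int where "e = of_bool (inv w i < inv w j)"
    have e: "of_bool (inv w i < inv w j) = real_of_int e" by (simp add: e_def)
    define r where "r = anchor ?t j - anchor ?t i"
    have r: "real_of_int e - 1 < r" "r < real_of_int e"
      using nabla_anchor_diff_bounds[OF w t ij'(1) ij(2) ij'(2)] unfolding e r_def by auto
    have yr: "anchor y j - anchor y i = of_int k + r"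
      unfolding r_def k[symmetric] anchor_y[OF ij'(1)] anchor_y[OF ij(2)] by simp
    have "real_of_int (b i j) \<le> of_int k + r \<longleftrightarrow> b i j \<le> k + (e - 1)"
      using r by linarith
    moreover have "of_int k + r \<le> real_of_int (c i j) \<longleftrightarrow> k + e \<le> c i j"
      using r by linarith
    ultimately show ?thesis unfolding yr k e by linarith
  qed
  then show ?thesis unfolding fits_def by blast
qed

text \<open>Each fitting cell has volume 1 / m!, which the normalizing factor turns into 1.\<close>

lemma normalized_volume_alcoved_set:
  assumes n: "n \<ge> 1"
  shows "normalized_volume n (alcoved_set n l b c) =
    (\<Sum>w | w permutes {1..n - 1}. real (card {a \<in> lattice_points (n - 1). fits (n - 1) b c w a}))"
proof -
  define m where "m = n - 1"
  have n': "n = Suc m" using n by (simp add: m_def)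
  \<comment> \<open>The projected polytope in partial-sum coordinates; the bounded quantifiers
    exhibit it as a finite intersection of measurable sets.\<close>
  let ?Q = "{y \<in> space (lborel_pow m). \<forall>i\<in>{..m}. \<forall>j\<in>{..m}. i < j \<longrightarrow>
      of_int (b i j) \<le> anchor y j - anchor y i \<and> anchor y j - anchor y i \<le> of_int (c i j)}"
  let ?A = "\<lambda>w. {a \<in> lattice_points m. fits m b c w a}"
  let ?P = "{w. w permutes {1..m}}"
  \<comment> \<open>With the permutation first, the count splits into a sum over w; the swap gives
    the pairs (a, w) that \<open>measure_union_of_cells\<close> takes.\<close>
  let ?F = "prod.swap ` (SIGMA w:?P. ?A w)"
  have Q: "?Q \<in> sets (lborel_pow m)"
  proof (intro sets.sets_Collect_finite_All)
    fix i j assume ij: "i \<in> {..m}" "j \<in> {..m}"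
    note meas = borel_measurable_diff[OF measurable_anchor[of j m] measurable_anchor[of i m]]
    have "{y \<in> space (lborel_pow m). of_int (b i j) \<le> anchor y j - anchor y i \<and>
        anchor y j - anchor y i \<le> of_int (c i j)} \<in> sets (lborel_pow m)"
      using ij by (intro sets.sets_Collect_conj borel_measurable_le borel_measurable_const meas) auto
    then show "{y \<in> space (lborel_pow m). i < j \<longrightarrow> of_int (b i j) \<le> anchor y j - anchor y i \<and>
        anchor y j - anchor y i \<le> of_int (c i j)} \<in> sets (lborel_pow m)"
      by (cases "i < j") simp_all
  qed simp_all
  have Q_iff: "y \<in> ?Q \<longleftrightarrow> y \<in> rpoints m \<and> (\<forall>i j. i < j \<and> j \<le> m \<longrightarrow>
      of_int (b i j) \<le> anchor y j - anchor y i \<and> anchor y j - anchor y i \<le> of_int (c i j))" for y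
    unfolding space_lborel_pow mem_Collect_eq by (auto simp: Ball_def dest: less_imp_le_nat)
  have seg: "anchor (psum m z) j - anchor (psum m z) i = (\<Sum>k = i + 1..j. z k)" if "i < j" "j \<le> m" for i j z
    unfolding sum_segment_eq_diff[OF less_imp_le_nat[OF that(1)]]
    using that by (simp add: anchor_psum)
  have "(\<lambda>x. restrict x {1..m}) ` alcoved_set n l b c = psum m -` ?Q \<inter> space (lborel_pow m)"
  proof (intro set_eqI iffI)
    fix z assume "z \<in> (\<lambda>x. restrict x {1..m}) ` alcoved_set n l b c"
    then obtain x where x: "x \<in> alcoved_set n l b c" "z = restrict x {1..m}" by blast
    have "(\<Sum>k = i + 1..j. z k) = (\<Sum>k = i + 1..j. x k)" if "j \<le> m" for i j
      using that x(2) by (intro sum.cong) auto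
    moreover have "z \<in> rpoints m" "psum m z \<in> rpoints m" using x(2) by (simp_all add: psum_def)
    ultimately show "z \<in> psum m -` ?Q \<inter> space (lborel_pow m)"
      using x(1) seg unfolding m_def[symmetric] vimage_eq Int_iff Q_iff space_lborel_pow by auto
  next
    fix z assume z: "z \<in> psum m -` ?Q \<inter> space (lborel_pow m)"
    then have zr: "z \<in> rpoints m" unfolding space_lborel_pow by blast
    have zQ: "\<forall>i j. i < j \<and> j \<le> m \<longrightarrow> of_int (b i j) \<le> anchor (psum m z) j - anchor (psum m z) i \<and>
        anchor (psum m z) j - anchor (psum m z) i \<le> of_int (c i j)"
      using z unfolding vimage_eq Int_iff Q_iff by (elim conjE)
    let ?x = "\<lambda>k\<in>{1..n}. if k = n then of_int l - (\<Sum>k = 1..m. z k) else z k"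
    have r: "restrict ?x {1..m} = z"
      using zr unfolding n' by (intro ext) (auto simp: PiE_iff extensional_def restrict_def)
    have s: "(\<Sum>k = i + 1..j. ?x k) = (\<Sum>k = i + 1..j. z k)" if "j \<le> m" for i j
      using that n' by (intro sum.cong) auto
    have "(\<Sum>k = 1..m. ?x k) = (\<Sum>k = 1..m. z k)"
      using s[of m 0] by simp
    then have "(\<Sum>k = 1..n. ?x k) = of_int l" unfolding n' by simp
    moreover have "of_int (b i j) \<le> (\<Sum>k = i + 1..j. ?x k) \<and> (\<Sum>k = i + 1..j. ?x k) \<le> of_int (c i j)"
      if "i < j" "j \<le> m" for i j
      using zQ[rule_format, OF conjI[OF that]] unfolding seg[OF that] s[OF that(2)] .
    ultimately have "?x \<in> alcoved_set n l b c" 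
      unfolding m_def[symmetric] mem_Collect_eq by (intro conjI allI impI) auto
    then show "z \<in> (\<lambda>x. restrict x {1..m}) ` alcoved_set n l b c"
      by (rule image_eqI[where f = "\<lambda>x. restrict x {1..m}", OF r[symmetric]])
  qed
  then have "measure (lborel_pow m) ((\<lambda>x. restrict x {1..m}) ` alcoved_set n l b c)
      = measure (distr (lborel_pow m) (lborel_pow m) (psum m)) ?Q"
    using measure_distr[OF measurable_psum Q] by simp
  also have "\<dots> = measure (lborel_pow m) ?Q" by (simp only: distr_psum)
  also have "\<dots> = real (card ?F) * measure (lborel_pow m) (nabla m id)"
  proof (rule measure_union_of_cells[OF Q])
    show "finite ?F" by (intro finite_imageI finite_SigmaI finite_fits) (simp add: finite_permutations)
    fix a w
    show "a \<in> lattice_points m \<and> w permutes {1..m}" if "(a, w) \<in> ?F" using that by auto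
    fix y assume aw: "a \<in> lattice_points m" "w permutes {1..m}" "y \<in> cell m a w"
    then have "y \<in> ?Q \<longleftrightarrow> fits m b c w a"
      unfolding Q_iff cell_mem_bounds_iff[OF aw] by (simp add: cell_def)
    then show "y \<in> ?Q \<longleftrightarrow> (a, w) \<in> ?F" using aw by (auto simp: image_iff)
  qed
  also have "card ?F = card (SIGMA w:?P. ?A w)" by (rule card_image) simp
  also have "\<dots> = (\<Sum>w\<in>?P. card (?A w))"
    by (rule card_SigmaI) (simp_all add: finite_fits finite_permutations del: One_nat_def)
  finally have vol: "measure (lborel_pow m) ((\<lambda>x. restrict x {1..m}) ` alcoved_set n l b c)
      = real (\<Sum>w\<in>?P. card (?A w)) * measure (lborel_pow m) (nabla m id)" .
  show ?thesis
    unfolding normalized_volume_def vol[unfolded m_def] measure_nabla_id by simp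
qed

theorem theorem3p2:
  fixes n :: nat and P :: "(nat \<Rightarrow> real) set"
  assumes "n \<ge> 1" and "alcoved_polytope n P"
  shows "(\<forall>w. w permutes {1..n - 1} \<longrightarrow> alcoved_polytope n (translation_polytope n P w)) \<and>
         normalized_volume n P =
           (\<Sum>w | w permutes {1..n - 1}. real (lattice_count n (translation_polytope n P w)))"
proof -
  obtain l b c where P: "P = alcoved_set n l b c"
    using assms(2) unfolding alcoved_polytope_def by blast
  show ?thesis
    unfolding P normalized_volume_alcoved_set[OF assms(1)]
    using alcoved_polytope_translation_polytope[OF assms(1)] lattice_count_translation_polytope[OF assms(1)]
    by (intro conjI allI impI sum.cong) auto
qed

end
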